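(* Let $\theta$ be a non-constant inner function in $\mathbb{D}$ and let $\zeta\in\mathbb{T}$. If $K_\theta$ has strong localization at $\zeta$, then $K_\theta$ has the localization property at $\zeta$.
   Context: $\mathbb{D}$ is the open unit disc, $\mathbb{T}$ the unit circle, $H^2=H^2(\mathbb{D})$ the Hardy space. For an inner function $\theta$ in $\mathbb{D}$, the model space is $K_\theta=H^2\ominus\theta H^2$. Localization: for $\gamma>1$ the Stolz angle at $\zeta\in\mathbb{T}$ is $\Gamma_\gamma(\zeta)=\{z\in\mathbb{D}:|z-\zeta|\le\gamma(1-|z|)\}$. The space $K_\theta$ has the localization property at $\zeta$ if every nonzero $f\in K_\theta$ has only finitely many zeros in any Stolz angle at $\zeta$. Let $z_j$ be the zeros of $\theta$ (counting multiplicities) and $\nu$ the positive singular measure on $\mathbb{T}$ generating the singular inner factor of $\theta$. For an integer $n\ge0$, $AC_n(\theta)$ is the set of $\zeta\in\mathbb{T}$ such that $\sum_j\frac{1-|z_j|^2}{|\zeta-z_j|^{2n+2}}+\int_{\mathbb{T}}\frac{d\nu(z)}{|\zeta-z|^{2n+2}}<\infty$. For $\alpha\in\mathbb{T}$ the Clark measure $\sigma_\alpha$ is the (unique, finite, positive, singular) Borel measure on $\mathbb{T}$ such that $\operatorname{Re}\frac{\alpha+\theta(z)}{\alpha-\theta(z)}=\int_{\mathbb{T}}\operatorname{Re}\frac{1+\overline{\xi}z}{1-\overline{\xi}z}\,d\sigma_\alpha(\xi)$ for $z\in\mathbb{D}$. Strong localization: let $\zeta\in\bigcap_{n\ge0}AC_n(\theta)$.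 $K_\theta$ has strong localization at $\zeta$ if the system $\{(z-\zeta)^{-k}\}_{k\ge1}$ is complete in $L^2(\sigma_\alpha)$ for some (any) $\alpha\in\mathbb{T}$ such that $\sigma_\alpha(\{\zeta\})=0$. In particular, strong localization at $\zeta$ includes the requirement $\zeta\in\bigcap_{n\ge0}AC_n(\theta)$. *)

theory Defs
  imports "HOL-Complex_Analysis.Complex_Analysis"
begin

text \<open>Functions on the unit disc are total functions \<^typ>\<open>complex \<Rightarrow> complex\<close>; only their values on
  \<^term>\<open>ball 0 1 :: complex set\<close> matter.\<close>

definition circle_borel :: "complex measure" where
  "circle_borel = restrict_space borel (sphere 0 1)"

definition arc_length :: "complex measure" where
  "arc_length = distr (restrict_space lborel {0..<2*pi}) circle_borel cis"

definition finite_circle_measure :: "complex measure \<Rightarrow> bool" where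
  "finite_circle_measure \<mu> \<longleftrightarrow> finite_measure \<mu> \<and> sets \<mu> = sets circle_borel"

definition singular_circle_measure :: "complex measure \<Rightarrow> bool" where
  "singular_circle_measure \<mu> \<longleftrightarrow>
     (\<exists>A\<in>sets circle_borel. emeasure \<mu> A = 0 \<and> emeasure arc_length (sphere 0 1 - A) = 0)"

definition taylor_coeff :: "(complex \<Rightarrow> complex) \<Rightarrow> nat \<Rightarrow> complex" where
  "taylor_coeff f n = (deriv ^^ n) f 0 / fact n"

definition H2 :: "(complex \<Rightarrow> complex) set" where
  "H2 = {f. f holomorphic_on ball 0 1 \<and> summable (\<lambda>n. (norm (taylor_coeff f n))\<^sup>2)}"

definition H2_inner :: "(complex \<Rightarrow> complex) \<Rightarrow> (complex \<Rightarrow> complex) \<Rightarrow> complex" where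
  "H2_inner f g = (\<Sum>n. taylor_coeff f n * cnj (taylor_coeff g n))"

definition inner_function :: "(complex \<Rightarrow> complex) \<Rightarrow> bool" where
  "inner_function \<theta> \<longleftrightarrow>
     \<theta> holomorphic_on ball 0 1 \<and> (\<forall>z\<in>ball 0 1. norm (\<theta> z) \<le> 1) \<and>
     (AE \<xi> in arc_length. \<exists>l. norm l = 1 \<and> ((\<lambda>r. \<theta> (of_real r * \<xi>)) \<longlongrightarrow> l) (at_left (1::real)))"

definition model_space :: "(complex \<Rightarrow> complex) \<Rightarrow> (complex \<Rightarrow> complex) set" where
  "model_space \<theta> = {f \<in> H2. \<forall>g\<in>H2. H2_inner f (\<lambda>z. \<theta> z * g z) = 0}"

definition stolz_angle :: "real \<Rightarrow> complex \<Rightarrow> complex set" where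
  "stolz_angle \<gamma> \<zeta> = {z \<in> ball 0 1. norm (z - \<zeta>) \<le> \<gamma> * (1 - norm z)}"

definition localization_property :: "(complex \<Rightarrow> complex) \<Rightarrow> complex \<Rightarrow> bool" where
  "localization_property \<theta> \<zeta> \<longleftrightarrow>
     (\<forall>f\<in>model_space \<theta>. (\<exists>z\<in>ball 0 1. f z \<noteq> 0) \<longrightarrow>
        (\<forall>\<gamma>>1. finite {z \<in> stolz_angle \<gamma> \<zeta>. f z = 0}))"

definition disc_zeros :: "(complex \<Rightarrow> complex) \<Rightarrow> complex set" where
  "disc_zeros \<theta> = {z \<in> ball 0 1. \<theta> z = 0}"

definition zero_mult :: "(complex \<Rightarrow> complex) \<Rightarrow> complex \<Rightarrow> nat" where
  "zero_mult \<theta> a = nat (zorder \<theta> a)"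

definition blaschke_factor :: "complex \<Rightarrow> complex \<Rightarrow> complex" where
  "blaschke_factor a z =
     (if a = 0 then z else of_real (norm a) / a * ((a - z) / (1 - cnj a * z)))"

text \<open>\<open>\<nu>\<close> generates the singular inner factor in the factorization
  $\theta = c B S_\nu$, where $|c| = 1$, $S_\nu(z) = \exp(-\int \frac{\xi+z}{\xi-z}\,d\nu(\xi))$, and $B$ is
  the Blaschke product over the zeros of \<open>\<theta>\<close>, taken as an unordered infinite product.\<close>

definition generates_singular_factor :: "(complex \<Rightarrow> complex) \<Rightarrow> complex measure \<Rightarrow> bool" where
  "generates_singular_factor \<theta> \<nu> \<longleftrightarrow>
     finite_circle_measure \<nu> \<and> singular_circle_measure \<nu> \<and>
     (\<exists>c B. norm c = 1 \<and> (\<forall>z\<in>ball 0 1.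
        ((\<lambda>F. \<Prod>a\<in>F. blaschke_factor a z ^ zero_mult \<theta> a) \<longlongrightarrow> B z)
          (finite_subsets_at_top (disc_zeros \<theta>)) \<and>
        \<theta> z = c * B z * exp (- (\<integral>\<xi>. (\<xi> + z) / (\<xi> - z) \<partial>\<nu>))))"

text \<open>The integral against \<open>\<nu>\<close> takes values in \<^typ>\<open>ennreal\<close>, where division by zero gives \<open>\<infinity>\<close>: an atom
  of \<open>\<nu>\<close> at \<open>\<zeta>\<close> excludes \<open>\<zeta>\<close>. The measure \<open>\<nu>\<close> is uniquely determined by \<open>\<theta>\<close>.\<close>

definition AC :: "nat \<Rightarrow> (complex \<Rightarrow> complex) \<Rightarrow> complex set" where
  "AC n \<theta> = {\<zeta> \<in> sphere 0 1.
     (\<lambda>a. real (zero_mult \<theta> a) * ((1 - (norm a)\<^sup>2) / norm (\<zeta> - a) ^ (2 * n + 2)))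
       summable_on disc_zeros \<theta> \<and>
     (\<exists>\<nu>. generates_singular_factor \<theta> \<nu> \<and>
        (\<integral>\<^sup>+\<xi>. 1 / ennreal (norm (\<zeta> - \<xi>) ^ (2 * n + 2)) \<partial>\<nu>) < \<infinity>)}"

definition clark_measure :: "(complex \<Rightarrow> complex) \<Rightarrow> complex \<Rightarrow> complex measure \<Rightarrow> bool" where
  "clark_measure \<theta> \<alpha> \<sigma> \<longleftrightarrow>
     finite_circle_measure \<sigma> \<and> singular_circle_measure \<sigma> \<and>
     (\<forall>z\<in>ball 0 1. Re ((\<alpha> + \<theta> z) / (\<alpha> - \<theta> z)) =
        (\<integral>\<xi>. Re ((1 + cnj \<xi> * z) / (1 - cnj \<xi> * z)) \<partial>\<sigma>))"

definition L2 :: "complex measure \<Rightarrow> (complex \<Rightarrow> complex) set" where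
  "L2 \<mu> = {f \<in> borel_measurable \<mu>. integrable \<mu> (\<lambda>x. (norm (f x))\<^sup>2)}"

definition complete_in_L2 :: "complex measure \<Rightarrow> 'i set \<Rightarrow> ('i \<Rightarrow> complex \<Rightarrow> complex) \<Rightarrow> bool" where
  "complete_in_L2 \<mu> I e \<longleftrightarrow>
     (\<forall>k\<in>I. e k \<in> L2 \<mu>) \<and>
     (\<forall>f\<in>L2 \<mu>. \<forall>\<epsilon>>0. \<exists>F c. finite F \<and> F \<subseteq> I \<and>
        (\<integral>x. (norm (f x - (\<Sum>k\<in>F. c k * e k x)))\<^sup>2 \<partial>\<mu>) < \<epsilon>)"

text \<open>At \<open>z = \<zeta>\<close> the functions below take the junk value \<open>0\<close>, on a \<open>\<sigma>\<close>-null set.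
  The Clark measure \<open>\<sigma>\<close> is uniquely determined by \<open>\<theta>\<close> and \<open>\<alpha>\<close>; the condition does not depend on the
  choice of \<open>\<alpha>\<close>.\<close>

definition strong_localization :: "(complex \<Rightarrow> complex) \<Rightarrow> complex \<Rightarrow> bool" where
  "strong_localization \<theta> \<zeta> \<longleftrightarrow>
     \<zeta> \<in> (\<Inter>n. AC n \<theta>) \<and>
     (\<exists>\<alpha>\<in>sphere 0 1. \<exists>\<sigma>. clark_measure \<theta> \<alpha> \<sigma> \<and> emeasure \<sigma> {\<zeta>} = 0 \<and>
        complete_in_L2 \<sigma> {1::nat..} (\<lambda>k z. 1 / (z - \<zeta>) ^ k))"

end

theory Submission
  imports Defs
begin

text \<open>
  Fix a Clark measure \<open>\<sigma>\<close> for which the system of poles \<open>1 / (\<xi> - \<zeta>) ^ k\<close>, \<open>k \<ge> 1\<close>, is complete in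
  \<open>L\<^sup>2(\<sigma>)\<close>, let \<open>f\<close> lie in the model space, and suppose that \<open>f\<close> vanishes on an infinite subset \<open>Z\<close> of
  a Stolz angle at \<open>\<zeta>\<close>. Two facts force \<open>f = 0\<close>.

  First, Clark's unitary map identifies the model space with \<open>L\<^sup>2(\<sigma>)\<close> so that evaluation of
  \<open>f / (\<alpha> - \<theta>)\<close> at \<open>w\<close> corresponds to pairing with the Cauchy kernel \<open>1 / (\<xi> - w)\<close>. It enters
  through the following estimate, in which \<open>M\<close> is the squared norm of \<open>f\<close>:
  \<open>\<bar>\<Sum> b w * f w / (\<alpha> - \<theta> w)\<bar>\<^sup>2 \<le> M * \<integral> \<bar>\<Sum> b w / (\<xi> - w)\<bar>\<^sup>2 d\<sigma>\<close> for all finite sums (lemma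
  \<open>clark_evaluation_bound\<close>). The reasons for the estimate are these: the reproducing
  kernels \<open>(1 - cnj (\<theta> w) * \<theta> z) / (1 - cnj w * z)\<close> evaluate functions of the model space, the Gram
  matrix of the kernels dominates their norm because multiplication by \<open>\<theta>\<close> is a contraction
  (\<open>model_space_evaluation_bound\<close>), and the same Gram matrix, rescaled, is that of the Cauchy
  kernels in \<open>L\<^sup>2(\<sigma>)\<close> (\<open>clark_kernel\<close>). Consequently, if \<open>1 / (\<xi> - w)\<close> is a limit in \<open>L\<^sup>2(\<sigma>)\<close> of
  combinations of the kernels \<open>1 / (\<xi> - z)\<close> with \<open>z \<in> Z\<close>, then \<open>f w = 0\<close>.

  Secondly, every Cauchy kernel is such a limit. The zeros accumulate at \<open>\<zeta>\<close>, and as \<open>z\<close> tends to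
  \<open>\<zeta>\<close> inside the Stolz angle, \<open>1 / (\<xi> - z)\<close> has an asymptotic expansion in \<open>L\<^sup>2(\<sigma>)\<close> whose
  coefficients are the poles at \<open>\<zeta>\<close>. Peeling off the coefficients one after the other puts
  every pole into the closed span of the kernels (\<open>poles_in_closed_span_cauchy_kernels\<close>), and by
  completeness the poles generate all of \<open>L\<^sup>2(\<sigma>)\<close>.
\<close>

section \<open>Taylor coefficients and contractive multipliers of the Hardy space\<close>

lemma taylor_coeff_sums:
  assumes "f holomorphic_on ball 0 1" "z \<in> ball 0 1"
  shows "(\<lambda>n. taylor_coeff f n * z ^ n) sums f z"
  using holomorphic_power_series[OF assms] by (simp add: taylor_coeff_def)

lemma taylor_coeff_unique:
  assumes "\<And>z. z \<in> ball 0 1 \<Longrightarrow> (\<lambda>n. b n * z ^ n) sums f z"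
  shows "taylor_coeff f n = b n"
proof -
  have "\<forall>\<^sub>F z in nhds 0. z \<in> ball (0::complex) 1"
    by (intro eventually_nhds_in_open) auto
  then have "f has_fps_expansion Abs_fps b"
    by (intro has_fps_expansionI) (auto elim!: eventually_mono intro: assms)
  from fps_nth_fps_expansion[OF this, of n] show ?thesis
    by (simp add: taylor_coeff_def)
qed

lemma integral_cis_multiple:
  "((\<lambda>t. cis (of_int k * t)) has_integral (if k = 0 then of_real (2 * pi) else 0)) {0..2*pi}"
proof (cases "k = 0")
  case True
  have "((\<lambda>t. 1::complex) has_integral (2 * pi - 0) *\<^sub>R 1) {0..2*pi}"
    using has_integral_const_real[of "1::complex" 0 "2*pi"] by simp
  then show ?thesis using True by (simp add: scaleR_conv_of_real)
next
  case False
  let ?F = "\<lambda>t::real. cis (of_int k * t) / (\<i> * of_int k)"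
  have "((\<lambda>t. cis (of_int k * t)) has_integral (?F (2*pi) - ?F 0)) {0..2*pi}"
  proof (rule fundamental_theorem_of_calculus)
    fix t :: real
    show "(?F has_vector_derivative cis (of_int k * t)) (at t within {0..2*pi})"
      unfolding has_vector_derivative_def using False
      by (auto intro!: derivative_eq_intros simp: field_simps scaleR_conv_of_real)
  qed simp
  moreover have "cis (of_int k * (2*pi)) = 1"
    by (metis cis_multiple_2pi Ints_of_int mult.commute)
  ultimately show ?thesis using False by simp
qed

lemma integral_square_trig_polynomial:
  fixes c :: "nat \<Rightarrow> complex"
  shows "((\<lambda>t. (\<Sum>n<N. c n * cis (real n * t)) * cnj (\<Sum>n<N. c n * cis (real n * t)))
           has_integral of_real (2 * pi * (\<Sum>n<N. (norm (c n))\<^sup>2))) {0..2*pi}"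
proof -
  have "((\<lambda>t. \<Sum>n<N. \<Sum>m<N. c n * cnj (c m) * cis (of_int (int n - int m) * t)) has_integral
      (\<Sum>n<N. \<Sum>m<N. c n * cnj (c m) * (if int n - int m = 0 then of_real (2 * pi) else 0))) {0..2*pi}"
    by (intro has_integral_sum finite_lessThan has_integral_mult_right integral_cis_multiple)
  moreover have "(\<Sum>n<N. c n * cis (real n * t)) * cnj (\<Sum>n<N. c n * cis (real n * t)) =
      (\<Sum>n<N. \<Sum>m<N. c n * cnj (c m) * cis (of_int (int n - int m) * t))" for t
    by (simp add: sum_product cis_cnj cis_mult algebra_simps)
  moreover have "(\<Sum>n<N. \<Sum>m<N. c n * cnj (c m) * (if int n - int m = 0 then of_real (2 * pi) else 0)) =
      of_real (2 * pi * (\<Sum>n<N. (norm (c n))\<^sup>2))"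
    by (simp add: if_distrib sum.delta' cong: if_cong)
       (simp add: complex_norm_square sum_distrib_left mult_ac del: of_real_power flip: of_real_power)
  ultimately show ?thesis by simp
qed

text \<open>Parseval's identity on a circle of radius \<open>r < 1\<close>: for partial sums of the Taylor series it is
  orthogonality of the characters, and the partial sums converge uniformly on the circle.\<close>

lemma parseval_circle:
  assumes f: "f holomorphic_on ball 0 1" and r: "0 < r" "r < 1"
  shows "(\<lambda>n. (norm (taylor_coeff f n) * r ^ n)\<^sup>2) sums
           (integral {0..2*pi} (\<lambda>t. (norm (f (of_real r * cis t)))\<^sup>2) / (2 * pi))"
    and "(\<lambda>t. (norm (f (of_real r * cis t)))\<^sup>2) integrable_on {0..2*pi}"
proof -
  define a where "a n = taylor_coeff f n * of_real r ^ n" for n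
  define S where "S N t = (\<Sum>n<N. a n * cis (real n * t))" for N t
  have trm: "taylor_coeff f n * (of_real r * cis t) ^ n = a n * cis (real n * t)" for n t
    by (simp add: a_def power_mult_distrib Complex.DeMoivre)
  have sm: "(\<lambda>n. a n * cis (real n * t)) sums f (of_real r * cis t)" for t
    using taylor_coeff_sums[OF f, of "of_real r * cis t"] r
    by (simp add: trm norm_mult)
  have "summable (\<lambda>n. norm (a n))"
  proof -
    \<comment> \<open>Convergence at a larger radius \<open>s < 1\<close> gives absolute convergence at \<open>r\<close>.\<close>
    define s where "s = (r + 1) / 2"
    have "summable (\<lambda>n. taylor_coeff f n * of_real s ^ n)"
      using taylor_coeff_sums[OF f, of "of_real s"] r by (auto simp: s_def sums_iff)
    from powser_insidea[OF this, of "of_real r"] r show ?thesis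
      by (simp add: a_def s_def)
  qed
  then have ul: "uniform_limit {0..2*pi} S (\<lambda>t. f (of_real r * cis t)) sequentially"
    unfolding S_def using sm
    by (intro Weierstrass_m_test[THEN uniform_limit_cong'[THEN iffD1, rotated -1]])
       (auto simp: norm_mult sums_iff)
  have cont: "continuous_on {0..2*pi} (S N)" for N
    unfolding S_def by (intro continuous_intros)
  have contf: "continuous_on {0..2*pi} (\<lambda>t. f (of_real r * cis t))"
    by (rule uniform_limit_theorem[OF _ ul]) (auto simp: cont)
  have bd: "bounded ((\<lambda>t. f (of_real r * cis t)) ` {0..2*pi})"
    by (intro compact_imp_bounded compact_continuous_image contf) simp
  have bdc: "bounded ((\<lambda>t. cnj (f (of_real r * cis t))) ` {0..2*pi})"
    by (intro compact_imp_bounded compact_continuous_image continuous_on_cnj contf) simp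
  have "uniform_limit {0..2*pi} (\<lambda>N t. S N t * cnj (S N t))
          (\<lambda>t. f (of_real r * cis t) * cnj (f (of_real r * cis t))) sequentially"
    by (intro uniform_lim_mult ul bd bdc bounded_linear.uniform_limit[OF bounded_linear_cnj])
  then obtain I J where
     I: "\<And>N. ((\<lambda>t. S N t * cnj (S N t)) has_integral I N) {0..2*pi}" and
     J: "((\<lambda>t. f (of_real r * cis t) * cnj (f (of_real r * cis t))) has_integral J) {0..2*pi}" and
     IJ: "I \<longlonglongrightarrow> J"
    by (rule uniform_limit_integral) (auto intro!: continuous_intros cont)
  have IN: "I N = of_real (2 * pi * (\<Sum>n<N. (norm (a n))\<^sup>2))" for N
    using has_integral_unique[OF I] integral_square_trig_polynomial[of a N] by (simp add: S_def)
  have "((\<lambda>t. Re (f (of_real r * cis t) * cnj (f (of_real r * cis t)))) has_integral Re J) {0..2*pi}"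
    using has_integral_linear[OF J bounded_linear_Re] by (simp add: o_def)
  then have RJ: "((\<lambda>t. (norm (f (of_real r * cis t)))\<^sup>2) has_integral Re J) {0..2*pi}"
    by (simp add: complex_norm_square[symmetric] del: of_real_power)
  have "(\<lambda>N. Re (I N)) \<longlonglongrightarrow> Re J" using IJ by (rule tendsto_Re)
  then have "(\<lambda>N. (2 * pi * (\<Sum>n<N. (norm (a n))\<^sup>2)) / (2 * pi)) \<longlonglongrightarrow> Re J / (2 * pi)"
    by (intro tendsto_intros) (auto simp: IN simp del: of_real_mult of_real_sum)
  then have "(\<lambda>n. (norm (a n))\<^sup>2) sums (Re J / (2 * pi))" by (simp add: sums_def)
  moreover have "norm (a n) = norm (taylor_coeff f n) * r ^ n" for n
    using r by (simp add: a_def norm_mult norm_power)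
  ultimately show "(\<lambda>n. (norm (taylor_coeff f n) * r ^ n)\<^sup>2) sums
           (integral {0..2*pi} (\<lambda>t. (norm (f (of_real r * cis t)))\<^sup>2) / (2 * pi))"
    using RJ by (simp add: integral_unique)
  show "(\<lambda>t. (norm (f (of_real r * cis t)))\<^sup>2) integrable_on {0..2*pi}"
    using RJ by blast
qed

text \<open>On each circle of radius \<open>r < 1\<close> the mean square of \<open>\<theta> * g\<close> is at most that of \<open>g\<close>. By Parseval
  this compares the coefficients weighted by \<open>r ^ n\<close>, and \<open>r\<close> tends to \<open>1\<close>.\<close>

lemma multiplier_contractive:
  assumes \<theta>: "\<theta> holomorphic_on ball 0 1" "\<And>z. z \<in> ball 0 1 \<Longrightarrow> norm (\<theta> z) \<le> 1" and g: "g \<in> H2"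
  shows "(\<lambda>z. \<theta> z * g z) \<in> H2"
    and "(\<Sum>n. (norm (taylor_coeff (\<lambda>z. \<theta> z * g z) n))\<^sup>2) \<le> (\<Sum>n. (norm (taylor_coeff g n))\<^sup>2)"
proof -
  let ?h = "\<lambda>z. \<theta> z * g z" and ?M = "\<Sum>n. (norm (taylor_coeff g n))\<^sup>2"
  have gh: "g holomorphic_on ball 0 1" and gs: "summable (\<lambda>n. (norm (taylor_coeff g n))\<^sup>2)"
    using g by (auto simp: H2_def)
  have hh: "?h holomorphic_on ball 0 1" by (intro holomorphic_intros \<theta> gh)
  have on_circle: "(\<Sum>n<N. (norm (taylor_coeff ?h n) * r ^ n)\<^sup>2) \<le> ?M" if r: "0 < r" "r < 1" for r N
  proof -
    have "(\<Sum>n<N. (norm (taylor_coeff ?h n) * r ^ n)\<^sup>2) \<le>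
        integral {0..2*pi} (\<lambda>t. (norm (?h (of_real r * cis t)))\<^sup>2) / (2 * pi)"
      using parseval_circle(1)[OF hh r] by (subst sums_unique[OF parseval_circle(1)[OF hh r]])
        (intro sum_le_suminf, auto simp: sums_iff)
    also have "\<dots> \<le> integral {0..2*pi} (\<lambda>t. (norm (g (of_real r * cis t)))\<^sup>2) / (2 * pi)"
    proof (intro divide_right_mono integral_le parseval_circle(2) hh gh r power_mono)
      fix t
      have "of_real r * cis t \<in> ball 0 1" using r by (simp add: norm_mult)
      from \<theta>(2)[OF this] show "norm (?h (of_real r * cis t)) \<le> norm (g (of_real r * cis t))"
        by (simp add: norm_mult mult_left_le_one_le)
    qed auto
    also have "\<dots> = (\<Sum>n. (norm (taylor_coeff g n) * r ^ n)\<^sup>2)"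
      by (rule sums_unique[OF parseval_circle(1)[OF gh r]])
    also have "\<dots> \<le> ?M"
    proof (rule suminf_le)
      show "summable (\<lambda>n. (norm (taylor_coeff g n) * r ^ n)\<^sup>2)"
        using parseval_circle(1)[OF gh r] by (simp add: sums_iff)
      show "(norm (taylor_coeff g n) * r ^ n)\<^sup>2 \<le> (norm (taylor_coeff g n))\<^sup>2" for n
        using r by (intro power_mono mult_right_le_one_le) (auto simp: power_le_one)
    qed (rule gs)
    finally show ?thesis .
  qed
  have partial: "(\<Sum>n<N. (norm (taylor_coeff ?h n))\<^sup>2) \<le> ?M" for N
  proof (rule tendsto_upperbound)
    show "((\<lambda>r. \<Sum>n<N. (norm (taylor_coeff ?h n) * r ^ n)\<^sup>2) \<longlongrightarrow>
        (\<Sum>n<N. (norm (taylor_coeff ?h n))\<^sup>2)) (at_left (1::real))"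
      by (rule tendsto_eq_intros | simp)+
    show "\<forall>\<^sub>F r in at_left (1::real). (\<Sum>n<N. (norm (taylor_coeff ?h n) * r ^ n)\<^sup>2) \<le> ?M"
      using eventually_at_left_real[of 0 1] by (auto elim!: eventually_mono intro: on_circle)
  qed simp
  then have "summable (\<lambda>n. (norm (taylor_coeff ?h n))\<^sup>2)"
    by (intro bounded_imp_summable[where B = ?M]) (auto simp del: sum.lessThan_Suc simp: lessThan_Suc_atMost[symmetric])
  with partial show "?h \<in> H2" "(\<Sum>n. (norm (taylor_coeff ?h n))\<^sup>2) \<le> ?M"
    using hh by (auto simp: H2_def intro: suminf_le_const)
qed

section \<open>Bounded evaluation functionals\<close>

lemma H2_inner_summable:
  assumes "f \<in> H2" "g \<in> H2"
  shows "summable (\<lambda>n. taylor_coeff f n * cnj (taylor_coeff g n))"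
proof (rule summable_comparison_test')
  show "summable (\<lambda>n. (norm (taylor_coeff f n))\<^sup>2 + (norm (taylor_coeff g n))\<^sup>2)"
    using assms by (intro summable_add) (auto simp: H2_def)
  fix n
  show "norm (taylor_coeff f n * cnj (taylor_coeff g n))
      \<le> (norm (taylor_coeff f n))\<^sup>2 + (norm (taylor_coeff g n))\<^sup>2"
    using sum_squares_bound[of "norm (taylor_coeff f n)" "norm (taylor_coeff g n)"]
      mult_nonneg_nonneg[OF norm_ge_zero[of "taylor_coeff f n"] norm_ge_zero[of "taylor_coeff g n"]]
    unfolding norm_mult complex_mod_cnj by linarith
qed

lemma Cauchy_Schwarz_series:
  fixes a b :: "nat \<Rightarrow> complex"
  assumes s: "summable (\<lambda>n. a n * b n)"
    and a: "summable (\<lambda>n. (norm (a n))\<^sup>2)" and b: "summable (\<lambda>n. (norm (b n))\<^sup>2)"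
  shows "(norm (\<Sum>n. a n * b n))\<^sup>2 \<le> (\<Sum>n. (norm (a n))\<^sup>2) * (\<Sum>n. (norm (b n))\<^sup>2)"
proof (rule tendsto_upperbound)
  show "(\<lambda>N. (norm (\<Sum>n<N. a n * b n))\<^sup>2) \<longlonglongrightarrow> (norm (\<Sum>n. a n * b n))\<^sup>2"
    using summable_LIMSEQ[OF s] by (intro tendsto_intros)
  show "\<forall>\<^sub>F N in sequentially. (norm (\<Sum>n<N. a n * b n))\<^sup>2
          \<le> (\<Sum>n. (norm (a n))\<^sup>2) * (\<Sum>n. (norm (b n))\<^sup>2)"
  proof (intro always_eventually allI)
    fix N
    have "norm (\<Sum>n<N. a n * b n) \<le> (\<Sum>n<N. norm (a n) * norm (b n))"
      by (rule order_trans[OF norm_sum]) (simp add: norm_mult)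
    then have "(norm (\<Sum>n<N. a n * b n))\<^sup>2 \<le> (\<Sum>n<N. norm (a n) * norm (b n))\<^sup>2"
      by (intro power_mono) auto
    also have "\<dots> \<le> (\<Sum>n<N. (norm (a n))\<^sup>2) * (\<Sum>n<N. (norm (b n))\<^sup>2)"
      by (rule Cauchy_Schwarz_ineq_sum)
    also have "\<dots> \<le> (\<Sum>n. (norm (a n))\<^sup>2) * (\<Sum>n. (norm (b n))\<^sup>2)"
      by (intro mult_mono sum_le_suminf a b suminf_nonneg sum_nonneg) auto
    finally show "(norm (\<Sum>n<N. a n * b n))\<^sup>2 \<le> \<dots>" .
  qed
qed simp

text \<open>\<open>1 / (1 - cnj w * z)\<close> is the Szego kernel, the reproducing kernel of the Hardy space at \<open>w\<close>.\<close>

definition szego_sum :: "complex set \<Rightarrow> (complex \<Rightarrow> complex) \<Rightarrow> complex \<Rightarrow> complex" where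
  "szego_sum W c z = (\<Sum>w\<in>W. c w / (1 - cnj w * z))"

context
  fixes W :: "complex set"
  assumes W: "finite W" "W \<subseteq> ball 0 1"
begin

lemma szego_sum_sums:
  assumes "z \<in> ball 0 1"
  shows "(\<lambda>n. (\<Sum>w\<in>W. c w * cnj w ^ n) * z ^ n) sums szego_sum W c z"
proof -
  have "(\<lambda>n. c w * (cnj w * z) ^ n) sums (c w * (1 / (1 - cnj w * z)))" if "w \<in> W" for w
  proof (intro sums_mult geometric_sums)
    have "norm w < 1" using that W by auto
    then show "norm (cnj w * z) < 1"
      using assms mult_strict_mono'[of "norm w" 1 "norm z" 1] by (simp add: norm_mult)
  qed
  then have "(\<lambda>n. \<Sum>w\<in>W. c w * (cnj w * z) ^ n) sums (\<Sum>w\<in>W. c w * (1 / (1 - cnj w * z)))"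
    by (rule sums_sum)
  then show ?thesis
    by (simp add: szego_sum_def power_mult_distrib sum_distrib_right mult.assoc)
qed

lemma taylor_coeff_szego_sum: "taylor_coeff (szego_sum W c) n = (\<Sum>w\<in>W. c w * cnj w ^ n)"
  by (rule taylor_coeff_unique) (rule szego_sum_sums)

lemma szego_sum_in_H2: "szego_sum W c \<in> H2"
proof -
  have "szego_sum W c holomorphic_on ball 0 1"
    by (rule power_series_holomorphic[where a = "\<lambda>n. \<Sum>w\<in>W. c w * cnj w ^ n"])
       (use szego_sum_sums in simp)
  moreover have "summable (\<lambda>n. (norm (\<Sum>w\<in>W. c w * cnj w ^ n))\<^sup>2)"
  proof -
    have sn: "summable (\<lambda>n. norm (\<Sum>w\<in>W. c w * cnj w ^ n))"
    proof (rule summable_comparison_test')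
      show "summable (\<lambda>n. \<Sum>w\<in>W. norm (c w) * norm w ^ n)"
        using W by (intro summable_sum summable_mult summable_geometric) auto
    qed (auto intro!: order_trans[OF norm_sum] simp: norm_mult norm_power)
    show ?thesis
    proof (rule summable_comparison_test')
      show "summable (\<lambda>n. (\<Sum>w\<in>W. norm (c w)) * norm (\<Sum>w\<in>W. c w * cnj w ^ n))"
        by (intro summable_mult sn)
      fix n
      have "norm (\<Sum>w\<in>W. c w * cnj w ^ n) \<le> (\<Sum>w\<in>W. norm (c w))"
        using W by (intro order_trans[OF norm_sum] sum_mono)
          (auto simp: norm_mult norm_power power_le_one mult_right_le_one_le subset_eq less_imp_le)
      then show "norm ((norm (\<Sum>w\<in>W. c w * cnj w ^ n))\<^sup>2)
          \<le> (\<Sum>w\<in>W. norm (c w)) * norm (\<Sum>w\<in>W. c w * cnj w ^ n)"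
        by (simp add: power2_eq_square mult_right_mono)
    qed
  qed
  ultimately show ?thesis by (simp add: H2_def taylor_coeff_szego_sum)
qed

text \<open>Reproducing property of the Szego kernels: pairing with \<open>1 / (1 - cnj w * z)\<close> evaluates the Taylor
  series at \<open>w\<close>.\<close>

lemma H2_inner_szego_sum:
  assumes "g holomorphic_on ball 0 1"
  shows "(\<lambda>n. taylor_coeff g n * cnj (taylor_coeff (szego_sum W c) n)) sums (\<Sum>w\<in>W. cnj (c w) * g w)"
proof -
  have "(\<lambda>n. \<Sum>w\<in>W. cnj (c w) * (taylor_coeff g n * w ^ n)) sums (\<Sum>w\<in>W. cnj (c w) * g w)"
    using W by (intro sums_sum sums_mult taylor_coeff_sums[OF assms]) auto
  then show ?thesis
    by (simp add: taylor_coeff_szego_sum sum_distrib_left mult_ac)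
qed

text \<open>Let \<open>S\<close> be the combination of Szego kernels with coefficients \<open>c\<close>, and let \<open>T\<close> be the one with
  coefficients \<open>c w * cnj (\<theta> w)\<close>. Then \<open>S - \<theta> * T\<close> is the combination of the kernels
  \<open>(1 - cnj (\<theta> w) * \<theta> z) / (1 - cnj w * z)\<close>, and pairing \<open>f\<close> with it is the same as pairing \<open>f\<close> with \<open>S\<close>, since \<open>f\<close> is orthogonal
  to \<open>\<theta> * T\<close>. The cross term \<open>\<langle>\<theta> * T, S\<rangle>\<close> equals \<open>\<parallel>T\<parallel>\<^sup>2\<close> by the reproducing property, so
  contractivity of \<open>\<theta>\<close> gives \<open>\<parallel>S - \<theta> * T\<parallel>\<^sup>2 \<le> \<parallel>S\<parallel>\<^sup>2 - \<parallel>T\<parallel>\<^sup>2\<close>, which is the quadratic form on the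
  right. The bound then is the Cauchy--Schwarz inequality.\<close>

lemma model_space_evaluation_bound:
  assumes \<theta>: "\<theta> holomorphic_on ball 0 1" "\<And>z. z \<in> ball 0 1 \<Longrightarrow> norm (\<theta> z) \<le> 1"
    and f: "f \<in> model_space \<theta>"
  shows "(norm (\<Sum>w\<in>W. cnj (c w) * f w))\<^sup>2 \<le> (\<Sum>n. (norm (taylor_coeff f n))\<^sup>2) *
    Re (\<Sum>w\<in>W. \<Sum>v\<in>W. cnj (c w) * c v * (1 - \<theta> w * cnj (\<theta> v)) / (1 - cnj v * w))"
proof -
  define S where "S = szego_sum W c"
  define T where "T = szego_sum W (\<lambda>w. c w * cnj (\<theta> w))"
  define U where "U = (\<lambda>z. \<theta> z * T z)"
  have ST: "S \<in> H2" "T \<in> H2" by (auto simp: S_def T_def szego_sum_in_H2)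
  have U: "U \<in> H2" "(\<Sum>n. (norm (taylor_coeff U n))\<^sup>2) \<le> (\<Sum>n. (norm (taylor_coeff T n))\<^sup>2)"
    unfolding U_def using multiplier_contractive[OF \<theta>] ST by auto
  have f': "f \<in> H2" "H2_inner f U = 0"
    using f ST by (auto simp: model_space_def U_def)
  have hol: "f holomorphic_on ball 0 1" "S holomorphic_on ball 0 1"
      "T holomorphic_on ball 0 1" "U holomorphic_on ball 0 1"
    using f' ST U by (auto simp: H2_def)
  let ?D = "\<lambda>n. taylor_coeff S n - taylor_coeff U n"
  have fU: "(\<lambda>n. taylor_coeff f n * cnj (taylor_coeff U n)) sums 0"
    using summable_sums[OF H2_inner_summable[OF f'(1) U(1)]] f'(2) by (simp add: H2_inner_def)
  have "(\<lambda>n. taylor_coeff f n * cnj (?D n)) sums (\<Sum>w\<in>W. cnj (c w) * f w)"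
    using sums_diff[OF H2_inner_szego_sum[OF hol(1), of c] fU]
    by (simp only: S_def[symmetric] right_diff_distrib complex_cnj_diff diff_0_right)
  note fD = this
  \<comment> \<open>\<open>X\<close> is both the cross term \<open>\<langle>U, S\<rangle>\<close> and the squared norm of \<open>T\<close>.\<close>
  define X where "X = (\<Sum>w\<in>W. cnj (c w) * U w)"
  have US: "(\<lambda>n. taylor_coeff U n * cnj (taylor_coeff S n)) sums X"
    unfolding S_def X_def by (rule H2_inner_szego_sum[OF hol(4)])
  have "(\<lambda>n. taylor_coeff T n * cnj (taylor_coeff T n)) sums X"
    using H2_inner_szego_sum[OF hol(3), of "\<lambda>w. c w * cnj (\<theta> w)"]
    by (simp only: T_def[symmetric] X_def U_def complex_cnj_mult complex_cnj_cnj mult.assoc)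
  from sums_Re[OF this] have TT: "(\<lambda>n. (norm (taylor_coeff T n))\<^sup>2) sums Re X"
    by (simp only: complex_norm_square[symmetric] Re_complex_of_real)
  from sums_Re[OF H2_inner_szego_sum[OF hol(2), of c]]
  have SS: "(\<lambda>n. (norm (taylor_coeff S n))\<^sup>2) sums Re (\<Sum>w\<in>W. cnj (c w) * S w)"
    by (simp only: S_def[symmetric] complex_norm_square[symmetric] Re_complex_of_real)
  have UU: "(\<lambda>n. (norm (taylor_coeff U n))\<^sup>2) sums (\<Sum>n. (norm (taylor_coeff U n))\<^sup>2)"
    using U by (intro summable_sums) (simp add: H2_def)
  have expand: "(norm (?D n))\<^sup>2 = (norm (taylor_coeff S n))\<^sup>2 + (norm (taylor_coeff U n))\<^sup>2
      - 2 * Re (taylor_coeff U n * cnj (taylor_coeff S n))" for n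
    by (simp add: cmod_power2) (simp add: power2_eq_square algebra_simps)
  have DD: "(\<lambda>n. (norm (?D n))\<^sup>2) sums (Re (\<Sum>w\<in>W. cnj (c w) * S w)
      + (\<Sum>n. (norm (taylor_coeff U n))\<^sup>2) - 2 * Re X)"
    unfolding expand by (intro sums_diff sums_add sums_mult sums_Re SS UU US)
  have "(norm (\<Sum>w\<in>W. cnj (c w) * f w))\<^sup>2 = (norm (\<Sum>n. taylor_coeff f n * cnj (?D n)))\<^sup>2"
    using fD by (simp add: sums_iff)
  also have "\<dots> \<le> (\<Sum>n. (norm (taylor_coeff f n))\<^sup>2) * (\<Sum>n. (norm (cnj (?D n)))\<^sup>2)"
    using fD f'(1) DD by (intro Cauchy_Schwarz_series) (auto simp: sums_iff H2_def simp del: complex_cnj_diff)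
  also have "\<dots> \<le> (\<Sum>n. (norm (taylor_coeff f n))\<^sup>2) *
      Re (\<Sum>w\<in>W. \<Sum>v\<in>W. cnj (c w) * c v * (1 - \<theta> w * cnj (\<theta> v)) / (1 - cnj v * w))"
  proof (rule mult_left_mono)
    have "(\<Sum>n. (norm (cnj (?D n)))\<^sup>2) \<le> Re (\<Sum>w\<in>W. cnj (c w) * S w) - Re X"
      using sums_unique[OF DD] sums_unique[OF TT] U(2) unfolding complex_mod_cnj by linarith
    also have "\<dots> = Re (\<Sum>w\<in>W. cnj (c w) * (S w - U w))"
      by (simp add: X_def right_diff_distrib sum_subtractf del: Re_sum)
    also have "(\<Sum>w\<in>W. cnj (c w) * (S w - U w)) =
        (\<Sum>w\<in>W. \<Sum>v\<in>W. cnj (c w) * c v * (1 - \<theta> w * cnj (\<theta> v)) / (1 - cnj v * w))"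
    proof (rule sum.cong[OF refl])
      fix w
      have "S w - U w = (\<Sum>v\<in>W. c v / (1 - cnj v * w) - \<theta> w * (c v * cnj (\<theta> v) / (1 - cnj v * w)))"
        by (simp add: S_def U_def T_def szego_sum_def sum_distrib_left sum_subtractf)
      also have "\<dots> = (\<Sum>v\<in>W. c v * (1 - \<theta> w * cnj (\<theta> v)) / (1 - cnj v * w))"
        by (intro sum.cong refl) (simp add: right_diff_distrib diff_divide_distrib mult_ac)
      finally show "cnj (c w) * (S w - U w) =
          (\<Sum>v\<in>W. cnj (c w) * c v * (1 - \<theta> w * cnj (\<theta> v)) / (1 - cnj v * w))"
        by (simp add: sum_distrib_left mult.assoc)
    qed
    finally show "(\<Sum>n. (norm (cnj (?D n)))\<^sup>2) \<le>
      Re (\<Sum>w\<in>W. \<Sum>v\<in>W. cnj (c w) * c v * (1 - \<theta> w * cnj (\<theta> v)) / (1 - cnj v * w))" .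
  qed (use f'(1) in \<open>auto simp: H2_def intro: suminf_nonneg\<close>)
  finally show ?thesis .
qed

end

section \<open>Clark measures and Cauchy kernels\<close>

lemma space_circle_measure: "finite_circle_measure \<sigma> \<Longrightarrow> space \<sigma> = sphere 0 1"
  using sets_eq_imp_space_eq[of \<sigma> circle_borel]
  by (simp add: finite_circle_measure_def circle_borel_def space_restrict_space)

lemma borel_measurable_circle_measure:
  assumes "finite_circle_measure \<sigma>" "f \<in> borel_measurable borel"
  shows "f \<in> borel_measurable \<sigma>"
proof -
  have "f \<in> borel_measurable circle_borel"
    unfolding circle_borel_def by (intro measurable_restrict_space1 assms)
  then show ?thesis
    using assms measurable_cong_sets[of \<sigma> circle_borel borel borel]
    by (auto simp: finite_circle_measure_def)
qed

lemma integrable_circle_measure_bounded: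
  fixes f :: "complex \<Rightarrow> complex"
  assumes "finite_circle_measure \<sigma>" "f \<in> borel_measurable borel" "\<And>\<xi>. norm \<xi> = 1 \<Longrightarrow> norm (f \<xi>) \<le> B"
  shows "integrable \<sigma> f"
proof -
  interpret finite_measure \<sigma> using assms by (simp add: finite_circle_measure_def)
  show ?thesis
    using assms(3) space_circle_measure[OF assms(1)] borel_measurable_circle_measure[OF assms(1,2)]
    by (intro integrable_const_bound[where B = B]) auto
qed

lemma norm_cauchy_kernel_le:
  fixes z \<xi> :: complex
  assumes "norm z < 1" "norm \<xi> = 1"
  shows "norm (1 / (\<xi> - z)) \<le> 1 / (1 - norm z)"
proof -
  have "1 - norm z \<le> norm (\<xi> - z)" using norm_triangle_ineq2[of \<xi> z] assms by simp
  then show ?thesis using assms by (simp add: norm_divide frac_le)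
qed

lemma integrable_cauchy_kernel_product:
  assumes "finite_circle_measure \<sigma>" "norm z < 1" "norm w < 1"
  shows "integrable \<sigma> (\<lambda>\<xi>. 1 / (\<xi> - z) * cnj (1 / (\<xi> - w)))"
proof (rule integrable_circle_measure_bounded[OF assms(1)])
  show "(\<lambda>\<xi>. 1 / (\<xi> - z) * cnj (1 / (\<xi> - w))) \<in> borel_measurable borel"
    unfolding complex_cnj_divide complex_cnj_one
    by (intro borel_measurable_times borel_measurable_divide borel_measurable_diff borel_measurable_const
        borel_measurable_continuous_onI continuous_intros)
  show "norm (1 / (\<xi> - z) * cnj (1 / (\<xi> - w))) \<le> (1 / (1 - norm z)) * (1 / (1 - norm w))"
    if "norm \<xi> = 1" for \<xi>
    unfolding norm_mult complex_mod_cnj using that assms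
    by (intro mult_mono norm_cauchy_kernel_le) auto
qed

text \<open>The kernel is a geometric series in \<open>z\<close> that may be integrated term by term.\<close>

lemma holomorphic_Cauchy_integral:
  assumes \<sigma>: "finite_circle_measure \<sigma>"
  shows "(\<lambda>z. \<integral>\<xi>. 1 / (1 - cnj \<xi> * z) \<partial>\<sigma>) holomorphic_on ball 0 1"
proof (rule power_series_holomorphic[where a = "\<lambda>n. \<integral>\<xi>. cnj \<xi> ^ n \<partial>\<sigma>"])
  fix z :: complex assume z: "z \<in> ball 0 1"
  interpret finite_measure \<sigma> using \<sigma> by (simp add: finite_circle_measure_def)
  have [measurable]: "cnj \<in> borel_measurable borel"
    by (intro borel_measurable_continuous_onI continuous_intros)
  have int: "integrable \<sigma> (\<lambda>\<xi>. cnj \<xi> ^ n)" for n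
    by (rule integrable_circle_measure_bounded[OF \<sigma>, where B = 1]) (auto simp: norm_power)
  have nz: "norm (cnj \<xi> * z) = norm z" if "\<xi> \<in> space \<sigma>" for \<xi>
    using that space_circle_measure[OF \<sigma>] by (simp add: norm_mult)
  have "(\<lambda>n. \<integral>\<xi>. cnj \<xi> ^ n * z ^ n \<partial>\<sigma>) sums (\<integral>\<xi>. (\<Sum>n. cnj \<xi> ^ n * z ^ n) \<partial>\<sigma>)"
  proof (rule sums_integral)
    show "integrable \<sigma> (\<lambda>\<xi>. cnj \<xi> ^ n * z ^ n)" for n
      using int by simp
    show "AE \<xi> in \<sigma>. summable (\<lambda>n. norm (cnj \<xi> ^ n * z ^ n))"
      using z by (intro AE_I2) (simp add: norm_power nz flip: power_mult_distrib)
    have "(\<integral>\<xi>. norm (cnj \<xi> ^ n * z ^ n) \<partial>\<sigma>) = norm z ^ n * measure \<sigma> (space \<sigma>)" for n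
    proof -
      have "(\<integral>\<xi>. norm (cnj \<xi> ^ n * z ^ n) \<partial>\<sigma>) = (\<integral>\<xi>. norm z ^ n \<partial>\<sigma>)"
        by (intro Bochner_Integration.integral_cong refl) (simp add: norm_power nz flip: power_mult_distrib)
      then show ?thesis by simp
    qed
    then show "summable (\<lambda>n. \<integral>\<xi>. norm (cnj \<xi> ^ n * z ^ n) \<partial>\<sigma>)"
      using z by (simp add: summable_mult2)
  qed
  moreover have "(\<integral>\<xi>. (\<Sum>n. cnj \<xi> ^ n * z ^ n) \<partial>\<sigma>) = (\<integral>\<xi>. 1 / (1 - cnj \<xi> * z) \<partial>\<sigma>)"
    using z by (intro Bochner_Integration.integral_cong refl)
      (simp add: suminf_geometric nz flip: power_mult_distrib)
  ultimately show "(\<lambda>n. (\<integral>\<xi>. cnj \<xi> ^ n \<partial>\<sigma>) * (z - 0) ^ n) sums (\<integral>\<xi>. 1 / (1 - cnj \<xi> * z) \<partial>\<sigma>)"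
    using int by simp
qed

text \<open>The image lies in a line, hence is not open.\<close>

lemma holomorphic_Re_0_constant:
  assumes f: "f holomorphic_on S" "open S" "connected S" and Re: "\<And>z. z \<in> S \<Longrightarrow> Re (f z) = 0"
  shows "f constant_on S"
proof (rule ccontr)
  assume nc: "\<not> f constant_on S"
  then obtain z where z: "z \<in> S" by (auto simp: constant_on_def)
  from nc have "open (f ` S)" using open_mapping_thm f by blast
  then obtain e where e: "e > 0" "ball (f z) e \<subseteq> f ` S"
    using z by (meson image_eqI openE)
  have "f z + of_real (e / 2) \<in> ball (f z) e" using e by (simp add: dist_norm)
  with e obtain w where "w \<in> S" "f w = f z + of_real (e / 2)" by (metis image_iff subsetD)
  with Re[of w] Re[of z] z e show False by simp
qed

text \<open>Keeps the denominators \<open>\<alpha> - \<theta> z\<close> below away from zero.\<close>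

lemma norm_less_1_if_nonconstant:
  assumes "\<theta> holomorphic_on ball 0 1" "\<And>z. z \<in> ball 0 1 \<Longrightarrow> norm (\<theta> z) \<le> 1"
    and "\<not> \<theta> constant_on ball (0::complex) 1" "z \<in> ball 0 1"
  shows "norm (\<theta> z) < (1::real)"
proof (rule ccontr)
  assume "\<not> norm (\<theta> z) < 1"
  then have "\<theta> constant_on ball 0 1"
    using assms by (intro maximum_modulus_principle[of \<theta> "ball 0 1" "ball 0 1" z]) force+
  with assms show False by simp
qed

text \<open>The defining property of the Clark measure says that \<open>H = (\<alpha> + \<theta>) / (\<alpha> - \<theta>)\<close> and the Herglotz
  integral \<open>P\<close> of \<open>\<sigma>\<close> have the same real part. They are both holomorphic, so they differ by an
  imaginary constant, which cancels in \<open>H z + cnj (H w)\<close>. Polarization of the Poisson kernel,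
  \<open>p z \<xi> + cnj (p w \<xi>) = 2 * (1 - z * cnj w) / ((\<xi> - z) * cnj (\<xi> - w))\<close> for \<open>\<xi>\<close> on the circle, and the
  corresponding formula for \<open>H\<close> then give the claim.\<close>

lemma clark_kernel:
  assumes \<theta>: "\<theta> holomorphic_on ball 0 1" "\<And>z. z \<in> ball 0 1 \<Longrightarrow> norm (\<theta> z) < 1"
    and \<alpha>: "norm \<alpha> = 1" and clark: "clark_measure \<theta> \<alpha> \<sigma>"
    and zw: "z \<in> ball 0 1" "w \<in> ball 0 1"
  shows "(\<integral>\<xi>. 1 / (\<xi> - z) * cnj (1 / (\<xi> - w)) \<partial>\<sigma>) =
    (1 - \<theta> z * cnj (\<theta> w)) / ((1 - z * cnj w) * (\<alpha> - \<theta> z) * cnj (\<alpha> - \<theta> w))"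
proof -
  have \<sigma>: "finite_circle_measure \<sigma>" using clark by (simp add: clark_measure_def)
  interpret finite_measure \<sigma> using \<sigma> by (simp add: finite_circle_measure_def)
  have [measurable]: "cnj \<in> borel_measurable borel"
    by (intro borel_measurable_continuous_onI continuous_intros)
  define p where "p u \<xi> = (1 + cnj \<xi> * u) / (1 - cnj \<xi> * u)" for u \<xi>
  define P where "P u = (\<integral>\<xi>. p u \<xi> \<partial>\<sigma>)" for u
  define H where "H u = (\<alpha> + \<theta> u) / (\<alpha> - \<theta> u)" for u
  have ne: "\<alpha> - \<theta> u \<noteq> 0" if "u \<in> ball 0 1" for u using \<theta>(2)[OF that] \<alpha> by auto
  have on_circle: "\<xi> * cnj \<xi> = 1" "1 - cnj \<xi> * u \<noteq> 0" "\<xi> - u \<noteq> 0" "1 / (1 - cnj \<xi> * u) = \<xi> / (\<xi> - u)"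
    if "u \<in> ball 0 1" "norm \<xi> = 1" for \<xi> u
  proof -
    show *: "\<xi> * cnj \<xi> = 1" using that by (metis complex_norm_square of_real_1 power_one)
    show **: "\<xi> - u \<noteq> 0" using that by auto
    have "\<xi> * (1 - cnj \<xi> * u) = \<xi> - u" by (simp add: right_diff_distrib * flip: mult.assoc)
    with ** show "1 - cnj \<xi> * u \<noteq> 0" "1 / (1 - cnj \<xi> * u) = \<xi> / (\<xi> - u)"
      by (auto simp: divide_simps)
  qed
  have p_eq: "p u \<xi> = 2 * (1 / (1 - cnj \<xi> * u)) - 1" if "u \<in> ball 0 1" "norm \<xi> = 1" for u \<xi>
    using on_circle(2)[OF that] by (simp add: p_def field_simps)
  have intC: "integrable \<sigma> (\<lambda>\<xi>. 1 / (1 - cnj \<xi> * u))" if u: "u \<in> ball 0 1" for u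
  proof (rule integrable_circle_measure_bounded[OF \<sigma>])
    show "norm (1 / (1 - cnj \<xi> * u)) \<le> 1 / (1 - norm u)" if "norm \<xi> = 1" for \<xi>
      using norm_cauchy_kernel_le[of u \<xi>] on_circle(4)[OF u that] u that by (simp add: norm_divide)
  qed measurable
  have int2: "integrable \<sigma> (\<lambda>\<xi>. 2 * (1 / (1 - cnj \<xi> * u)) - 1)" if u: "u \<in> ball 0 1" for u
    by (intro Bochner_Integration.integrable_diff integrable_mult_right intC u) simp
  have intp: "integrable \<sigma> (p u)" if u: "u \<in> ball 0 1" for u
    using int2[OF u] p_eq[OF u] space_circle_measure[OF \<sigma>]
    by (subst Bochner_Integration.integrable_cong[OF refl]) auto
  have P_eq: "P u = 2 * (\<integral>\<xi>. 1 / (1 - cnj \<xi> * u) \<partial>\<sigma>) - of_real (measure \<sigma> (space \<sigma>))"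
    if u: "u \<in> ball 0 1" for u
  proof -
    have "P u = (\<integral>\<xi>. 2 * (1 / (1 - cnj \<xi> * u)) - 1 \<partial>\<sigma>)"
      unfolding P_def using space_circle_measure[OF \<sigma>]
      by (intro Bochner_Integration.integral_cong refl p_eq u) auto
    also have "\<dots> = 2 * (\<integral>\<xi>. 1 / (1 - cnj \<xi> * u) \<partial>\<sigma>) - (\<integral>\<xi>. 1 \<partial>\<sigma>)"
      by (simp only: Bochner_Integration.integral_diff integrable_mult_right intC u integrable_const
          integral_mult_right_zero)
    finally show ?thesis by (simp add: scaleR_conv_of_real)
  qed
  have "(\<lambda>u. H u - P u) constant_on ball 0 1"
  proof (rule holomorphic_Re_0_constant)
    have "(\<lambda>u. H u - (2 * (\<integral>\<xi>. 1 / (1 - cnj \<xi> * u) \<partial>\<sigma>) - of_real (measure \<sigma> (space \<sigma>))))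
        holomorphic_on ball 0 1"
      unfolding H_def using ne
      by (intro holomorphic_intros \<theta>(1) holomorphic_Cauchy_integral[OF \<sigma>]) auto
    then show "(\<lambda>u. H u - P u) holomorphic_on ball 0 1"
      by (rule holomorphic_transform) (simp only: P_eq)
    show "Re (H u - P u) = 0" if u: "u \<in> ball 0 1" for u
    proof -
      have "Re (P u) = (\<integral>\<xi>. Re (p u \<xi>) \<partial>\<sigma>)"
        unfolding P_def by (rule integral_Re[OF intp[OF u], symmetric])
      also have "\<dots> = Re (H u)"
        using clark u unfolding clark_measure_def H_def p_def by simp
      finally show ?thesis by simp
    qed
  qed auto
  then have "H z - P z = H w - P w" using zw unfolding constant_on_def by metis
  moreover have "Re (H w - P w) = 0"
    using integral_Re[OF intp[OF zw(2)]] clark zw(2)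
    unfolding clark_measure_def H_def p_def P_def by simp
  ultimately have HP: "H z + cnj (H w) = P z + cnj (P w)"
    by (simp add: complex_eq_iff)
  have "P z + cnj (P w) = (\<integral>\<xi>. p z \<xi> + cnj (p w \<xi>) \<partial>\<sigma>)"
    unfolding P_def using intp zw by simp
  also have "\<dots> = (\<integral>\<xi>. 2 * (1 - z * cnj w) * (1 / (\<xi> - z) * cnj (1 / (\<xi> - w))) \<partial>\<sigma>)"
  proof (intro Bochner_Integration.integral_cong refl)
    fix \<xi> assume "\<xi> \<in> space \<sigma>"
    then have \<xi>: "norm \<xi> = 1" using space_circle_measure[OF \<sigma>] by simp
    have *: "p u \<xi> = (\<xi> + u) / (\<xi> - u)" if "u \<in> ball 0 1" for u
      using on_circle(3)[OF that \<xi>] unfolding p_eq[OF that \<xi>] on_circle(4)[OF that \<xi>]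
      by (simp add: field_simps)
    have d: "\<xi> - z \<noteq> 0" "cnj (\<xi> - w) \<noteq> 0" using on_circle(3) zw \<xi> by auto
    have "p z \<xi> + cnj (p w \<xi>) = (\<xi> + z) / (\<xi> - z) + cnj (\<xi> + w) / cnj (\<xi> - w)"
      using * zw by simp
    also have "\<dots> = ((\<xi> + z) * cnj (\<xi> - w) + cnj (\<xi> + w) * (\<xi> - z)) / ((\<xi> - z) * cnj (\<xi> - w))"
      by (rule add_frac_eq[OF d])
    also have "(\<xi> + z) * cnj (\<xi> - w) + cnj (\<xi> + w) * (\<xi> - z) = 2 * (\<xi> * cnj \<xi>) - 2 * (z * cnj w)"
      by (simp add: algebra_simps)
    finally show "p z \<xi> + cnj (p w \<xi>) = 2 * (1 - z * cnj w) * (1 / (\<xi> - z) * cnj (1 / (\<xi> - w)))"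
      using on_circle(1)[OF zw(1) \<xi>] by (simp add: right_diff_distrib)
  qed
  also have "\<dots> = 2 * (1 - z * cnj w) * (\<integral>\<xi>. 1 / (\<xi> - z) * cnj (1 / (\<xi> - w)) \<partial>\<sigma>)"
    by (rule integral_mult_right_zero)
  finally have 1: "H z + cnj (H w) = 2 * (1 - z * cnj w) * (\<integral>\<xi>. 1 / (\<xi> - z) * cnj (1 / (\<xi> - w)) \<partial>\<sigma>)"
    using HP by simp
  have d: "\<alpha> - \<theta> z \<noteq> 0" "cnj (\<alpha> - \<theta> w) \<noteq> 0" using ne zw by auto
  have "H z + cnj (H w) = (\<alpha> + \<theta> z) / (\<alpha> - \<theta> z) + cnj (\<alpha> + \<theta> w) / cnj (\<alpha> - \<theta> w)"
    by (simp add: H_def)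
  also have "\<dots> = ((\<alpha> + \<theta> z) * cnj (\<alpha> - \<theta> w) + cnj (\<alpha> + \<theta> w) * (\<alpha> - \<theta> z)) / ((\<alpha> - \<theta> z) * cnj (\<alpha> - \<theta> w))"
    by (rule add_frac_eq[OF d])
  also have "(\<alpha> + \<theta> z) * cnj (\<alpha> - \<theta> w) + cnj (\<alpha> + \<theta> w) * (\<alpha> - \<theta> z) =
      2 * (\<alpha> * cnj \<alpha>) - 2 * (\<theta> z * cnj (\<theta> w))"
    by (simp add: algebra_simps)
  also have "\<alpha> * cnj \<alpha> = 1" using \<alpha> by (metis complex_norm_square of_real_1 power_one)
  finally have 2: "H z + cnj (H w) = 2 * ((1 - \<theta> z * cnj (\<theta> w)) / ((\<alpha> - \<theta> z) * cnj (\<alpha> - \<theta> w)))"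
    by (simp add: diff_divide_distrib)
  have "norm (z * cnj w) < 1"
    using zw mult_strict_mono'[of "norm z" 1 "norm w" 1] by (simp add: norm_mult)
  then have zw1: "1 - z * cnj w \<noteq> 0" by auto
  have "(1 - z * cnj w) * (\<integral>\<xi>. 1 / (\<xi> - z) * cnj (1 / (\<xi> - w)) \<partial>\<sigma>) =
      (1 - \<theta> z * cnj (\<theta> w)) / ((\<alpha> - \<theta> z) * cnj (\<alpha> - \<theta> w))"
  proof -
    have "2 * ((1 - z * cnj w) * (\<integral>\<xi>. 1 / (\<xi> - z) * cnj (1 / (\<xi> - w)) \<partial>\<sigma>)) =
        2 * ((1 - \<theta> z * cnj (\<theta> w)) / ((\<alpha> - \<theta> z) * cnj (\<alpha> - \<theta> w)))"
      using trans[OF 1[symmetric] 2] by (simp only: mult.assoc)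
    then show ?thesis by (rule mult_left_cancel[THEN iffD1, rotated]) simp
  qed
  then have "(\<integral>\<xi>. 1 / (\<xi> - z) * cnj (1 / (\<xi> - w)) \<partial>\<sigma>) =
      (1 - \<theta> z * cnj (\<theta> w)) / ((\<alpha> - \<theta> z) * cnj (\<alpha> - \<theta> w)) / (1 - z * cnj w)"
    by (intro eq_divide_imp[OF zw1]) (simp only: mult.commute[of _ "1 - z * cnj w"])
  moreover have "x / (a * b) / d = x / (d * a * b)" for x a b d :: complex
    by (simp add: mult_ac)
  ultimately show ?thesis by (simp only:)
qed

text \<open>By the kernel identity, the rescaling \<open>c w = cnj (b w / (\<alpha> - \<theta> w))\<close> turns the quadratic form that
  bounds evaluations on the model space into a squared norm in \<open>L\<^sup>2(\<sigma>)\<close>.\<close>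

lemma clark_evaluation_bound:
  assumes \<theta>: "\<theta> holomorphic_on ball 0 1" "\<And>z. z \<in> ball 0 1 \<Longrightarrow> norm (\<theta> z) < 1"
    and \<alpha>: "norm \<alpha> = 1" and clark: "clark_measure \<theta> \<alpha> \<sigma>"
    and f: "f \<in> model_space \<theta>" and W: "finite W" "W \<subseteq> ball 0 1"
  shows "(norm (\<Sum>w\<in>W. b w * (f w / (\<alpha> - \<theta> w))))\<^sup>2 \<le>
    (\<Sum>n. (norm (taylor_coeff f n))\<^sup>2) * (\<integral>\<xi>. (norm (\<Sum>w\<in>W. b w * (1 / (\<xi> - w))))\<^sup>2 \<partial>\<sigma>)"
proof -
  have \<sigma>: "finite_circle_measure \<sigma>" using clark by (simp add: clark_measure_def)
  define c where "c w = cnj (b w / (\<alpha> - \<theta> w))" for w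
  let ?k = "\<lambda>w v \<xi>. 1 / (\<xi> - w) * cnj (1 / (\<xi> - v))"
  have int: "integrable \<sigma> (?k w v)" if "w \<in> W" "v \<in> W" for w v
    using that W by (intro integrable_cauchy_kernel_product[OF \<sigma>]) auto
  have sq: "of_real ((norm (\<Sum>w\<in>W. b w * (1 / (\<xi> - w))))\<^sup>2) = (\<Sum>w\<in>W. \<Sum>v\<in>W. b w * cnj (b v) * ?k w v \<xi>)" for \<xi>
    unfolding complex_norm_square cnj_sum sum_product by (simp add: mult_ac)
  have int2: "integrable \<sigma> (\<lambda>\<xi>. \<Sum>w\<in>W. \<Sum>v\<in>W. b w * cnj (b v) * ?k w v \<xi>)"
    by (intro Bochner_Integration.integrable_sum integrable_mult_right int)
  have "(\<integral>\<xi>. (norm (\<Sum>w\<in>W. b w * (1 / (\<xi> - w))))\<^sup>2 \<partial>\<sigma>) =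
      (\<integral>\<xi>. Re (\<Sum>w\<in>W. \<Sum>v\<in>W. b w * cnj (b v) * ?k w v \<xi>) \<partial>\<sigma>)"
    by (simp only: sq[symmetric] Re_complex_of_real)
  also have "\<dots> = Re (\<integral>\<xi>. (\<Sum>w\<in>W. \<Sum>v\<in>W. b w * cnj (b v) * ?k w v \<xi>) \<partial>\<sigma>)"
    by (rule integral_Re[OF int2])
  also have "(\<integral>\<xi>. (\<Sum>w\<in>W. \<Sum>v\<in>W. b w * cnj (b v) * ?k w v \<xi>) \<partial>\<sigma>) =
      (\<Sum>w\<in>W. \<Sum>v\<in>W. b w * cnj (b v) * (\<integral>\<xi>. ?k w v \<xi> \<partial>\<sigma>))"
    by (simp only: Bochner_Integration.integral_sum Bochner_Integration.integrable_sum
        integrable_mult_right int integral_mult_right_zero cong: sum.cong)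
  also have "\<dots> = (\<Sum>w\<in>W. \<Sum>v\<in>W. cnj (c w) * c v * (1 - \<theta> w * cnj (\<theta> v)) / (1 - cnj v * w))"
  proof (intro sum.cong refl)
    fix w v assume "w \<in> W" "v \<in> W"
    then have "w \<in> ball 0 1" "v \<in> ball 0 1" using W by auto
    from clark_kernel[OF \<theta> \<alpha> clark this]
    show "b w * cnj (b v) * (\<integral>\<xi>. ?k w v \<xi> \<partial>\<sigma>) =
        cnj (c w) * c v * (1 - \<theta> w * cnj (\<theta> v)) / (1 - cnj v * w)"
      by (simp add: c_def mult_ac)
  qed
  finally have "(\<integral>\<xi>. (norm (\<Sum>w\<in>W. b w * (1 / (\<xi> - w))))\<^sup>2 \<partial>\<sigma>) =
      Re (\<Sum>w\<in>W. \<Sum>v\<in>W. cnj (c w) * c v * (1 - \<theta> w * cnj (\<theta> v)) / (1 - cnj v * w))" .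
  moreover have "(\<Sum>w\<in>W. b w * (f w / (\<alpha> - \<theta> w))) = (\<Sum>w\<in>W. cnj (c w) * f w)"
    by (simp add: c_def)
  ultimately show ?thesis
    using model_space_evaluation_bound[OF W \<theta>(1) less_imp_le[OF \<theta>(2)] f, of c] by simp
qed

section \<open>Closed spans in $L^2$\<close>

text \<open>Integrates to a quasi-triangle inequality for squared \<open>L\<^sup>2\<close> norms.\<close>

lemma norm_add_square_le: "(norm (x + y :: complex))\<^sup>2 \<le> 2 * (norm x)\<^sup>2 + 2 * (norm y)\<^sup>2"
proof -
  have "(norm (x + y))\<^sup>2 \<le> (norm x + norm y)\<^sup>2"
    by (intro power_mono norm_triangle_ineq) auto
  also have "\<dots> \<le> 2 * (norm x)\<^sup>2 + 2 * (norm y)\<^sup>2"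
    using sum_squares_bound[of "norm x" "norm y"] by (simp add: power2_sum)
  finally show ?thesis .
qed

lemma L2_add:
  assumes f: "f \<in> L2 \<mu>" and g: "g \<in> L2 \<mu>"
  shows "(\<lambda>x. f x + g x) \<in> L2 \<mu>"
    and "(\<integral>x. (norm (f x + g x))\<^sup>2 \<partial>\<mu>) \<le> 2 * (\<integral>x. (norm (f x))\<^sup>2 \<partial>\<mu>) + 2 * (\<integral>x. (norm (g x))\<^sup>2 \<partial>\<mu>)"
proof -
  have [measurable]: "f \<in> borel_measurable \<mu>" "g \<in> borel_measurable \<mu>"
    and int: "integrable \<mu> (\<lambda>x. (norm (f x))\<^sup>2)" "integrable \<mu> (\<lambda>x. (norm (g x))\<^sup>2)"
    using f g by (auto simp: L2_def)
  have int2: "integrable \<mu> (\<lambda>x. 2 * (norm (f x))\<^sup>2 + 2 * (norm (g x))\<^sup>2)"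
    using int by simp
  have int3: "integrable \<mu> (\<lambda>x. (norm (f x + g x))\<^sup>2)"
    by (rule Bochner_Integration.integrable_bound[OF int2]) (auto simp: norm_add_square_le)
  then show "(\<lambda>x. f x + g x) \<in> L2 \<mu>" by (simp add: L2_def)
  have "(\<integral>x. (norm (f x + g x))\<^sup>2 \<partial>\<mu>) \<le> (\<integral>x. 2 * (norm (f x))\<^sup>2 + 2 * (norm (g x))\<^sup>2 \<partial>\<mu>)"
    by (intro integral_mono int2 int3 norm_add_square_le)
  also have "\<dots> = 2 * (\<integral>x. (norm (f x))\<^sup>2 \<partial>\<mu>) + 2 * (\<integral>x. (norm (g x))\<^sup>2 \<partial>\<mu>)"
    using int by simp
  finally show "(\<integral>x. (norm (f x + g x))\<^sup>2 \<partial>\<mu>) \<le> \<dots>" .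
qed

lemma L2_cmult: "f \<in> L2 \<mu> \<Longrightarrow> (\<lambda>x. c * f x) \<in> L2 \<mu>"
  by (auto simp: L2_def norm_mult power_mult_distrib)

lemma L2_diff: "f \<in> L2 \<mu> \<Longrightarrow> g \<in> L2 \<mu> \<Longrightarrow> (\<lambda>x. f x - g x) \<in> L2 \<mu>"
  using L2_add(1)[of f \<mu> "\<lambda>x. - 1 * g x"] L2_cmult[of g \<mu> "- 1"] by simp

lemma L2_zero: "(\<lambda>x. 0) \<in> L2 \<mu>"
  by (simp add: L2_def)

lemma L2_linear_combination:
  "finite F \<Longrightarrow> (\<And>k. k \<in> F \<Longrightarrow> e k \<in> L2 \<mu>) \<Longrightarrow> (\<lambda>x. \<Sum>k\<in>F. c k * e k x) \<in> L2 \<mu>"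
proof (induction F rule: finite_induct)
  case (insert j F)
  then have "(\<lambda>x. c j * e j x + (\<Sum>k\<in>F. c k * e k x)) \<in> L2 \<mu>"
    by (intro L2_add(1) L2_cmult) auto
  with insert.hyps show ?case by simp
qed (simp add: L2_zero)

definition L2_closed_span :: "complex measure \<Rightarrow> 'i set \<Rightarrow> ('i \<Rightarrow> complex \<Rightarrow> complex) \<Rightarrow> (complex \<Rightarrow> complex) set" where
  "L2_closed_span \<mu> I e = {f \<in> L2 \<mu>. \<forall>\<epsilon>>0. \<exists>F c. finite F \<and> F \<subseteq> I \<and>
        (\<integral>x. (norm (f x - (\<Sum>k\<in>F. c k * e k x)))\<^sup>2 \<partial>\<mu>) < \<epsilon>}"

lemma complete_in_L2_iff:
  "complete_in_L2 \<mu> I e \<longleftrightarrow> (\<forall>k\<in>I. e k \<in> L2 \<mu>) \<and> L2 \<mu> \<subseteq> L2_closed_span \<mu> I e"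
  unfolding complete_in_L2_def L2_closed_span_def by auto

lemma L2_closed_spanE:
  assumes "f \<in> L2_closed_span \<mu> I e" "\<epsilon> > 0"
  obtains F c where "finite F" "F \<subseteq> I" "(\<integral>x. (norm (f x - (\<Sum>k\<in>F. c k * e k x)))\<^sup>2 \<partial>\<mu>) < \<epsilon>"
  using assms unfolding L2_closed_span_def by blast

lemma L2_closed_span_imp_L2: "f \<in> L2_closed_span \<mu> I e \<Longrightarrow> f \<in> L2 \<mu>"
  by (simp add: L2_closed_span_def)

context
  fixes \<mu> :: "complex measure" and I :: "'i set" and e :: "'i \<Rightarrow> complex \<Rightarrow> complex"
  assumes eL2: "\<And>k. k \<in> I \<Longrightarrow> e k \<in> L2 \<mu>"
begin

lemma L2_closed_span_base: "k \<in> I \<Longrightarrow> e k \<in> L2_closed_span \<mu> I e"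
  unfolding L2_closed_span_def
  by (auto intro!: eL2 exI[of _ "{k}"] exI[of _ "\<lambda>_. 1"])

lemma L2_closed_span_zero: "(\<lambda>x. 0) \<in> L2_closed_span \<mu> I e"
  unfolding L2_closed_span_def by (auto intro!: L2_zero exI[of _ "{}"])

lemma L2_closed_span_closed:
  assumes f: "f \<in> L2 \<mu>"
    and approx: "\<And>\<epsilon>. \<epsilon> > 0 \<Longrightarrow> \<exists>g\<in>L2_closed_span \<mu> I e. (\<integral>x. (norm (f x - g x))\<^sup>2 \<partial>\<mu>) < \<epsilon>"
  shows "f \<in> L2_closed_span \<mu> I e"
  unfolding L2_closed_span_def
proof (intro CollectI conjI f allI impI)
  fix \<epsilon> :: real assume "\<epsilon> > 0"
  then have "\<epsilon> / 4 > 0" by simp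
  with approx obtain g where g: "g \<in> L2_closed_span \<mu> I e" "(\<integral>x. (norm (f x - g x))\<^sup>2 \<partial>\<mu>) < \<epsilon> / 4"
    by blast
  from L2_closed_spanE[OF g(1) \<open>\<epsilon> / 4 > 0\<close>] obtain F c where
    F: "finite F" "F \<subseteq> I" "(\<integral>x. (norm (g x - (\<Sum>k\<in>F. c k * e k x)))\<^sup>2 \<partial>\<mu>) < \<epsilon> / 4" .
  have gL: "g \<in> L2 \<mu>" using g by (simp add: L2_closed_span_imp_L2)
  have "(\<lambda>x. \<Sum>k\<in>F. c k * e k x) \<in> L2 \<mu>" using F eL2 by (intro L2_linear_combination) auto
  from L2_add(2)[OF L2_diff[OF f gL] L2_diff[OF gL this]]
  have "(\<integral>x. (norm (f x - (\<Sum>k\<in>F. c k * e k x)))\<^sup>2 \<partial>\<mu>) < \<epsilon>"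
    using F(3) g(2) by simp
  with F show "\<exists>F c. finite F \<and> F \<subseteq> I \<and> (\<integral>x. (norm (f x - (\<Sum>k\<in>F. c k * e k x)))\<^sup>2 \<partial>\<mu>) < \<epsilon>"
    by blast
qed

lemma L2_closed_span_add:
  assumes f: "f \<in> L2_closed_span \<mu> I e" and g: "g \<in> L2_closed_span \<mu> I e"
  shows "(\<lambda>x. f x + g x) \<in> L2_closed_span \<mu> I e"
  unfolding L2_closed_span_def
proof (intro CollectI conjI allI impI)
  have fg: "f \<in> L2 \<mu>" "g \<in> L2 \<mu>" using f g by (auto simp: L2_closed_span_imp_L2)
  then show "(\<lambda>x. f x + g x) \<in> L2 \<mu>" by (rule L2_add)
  fix \<epsilon> :: real assume "\<epsilon> > 0"
  then have e4: "\<epsilon> / 4 > 0" by simp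
  from L2_closed_spanE[OF f e4] obtain F c where
    F: "finite F" "F \<subseteq> I" "(\<integral>x. (norm (f x - (\<Sum>k\<in>F. c k * e k x)))\<^sup>2 \<partial>\<mu>) < \<epsilon> / 4" .
  from L2_closed_spanE[OF g e4] obtain G d where
    G: "finite G" "G \<subseteq> I" "(\<integral>x. (norm (g x - (\<Sum>k\<in>G. d k * e k x)))\<^sup>2 \<partial>\<mu>) < \<epsilon> / 4" .
  define h where "h k = (if k \<in> F then c k else 0) + (if k \<in> G then d k else 0)" for k
  have "(\<Sum>k\<in>F. c k * e k x) + (\<Sum>k\<in>G. d k * e k x) = (\<Sum>k\<in>F \<union> G. h k * e k x)" for x
  proof -
    have "(\<Sum>k\<in>F. c k * e k x) = (\<Sum>k\<in>F \<union> G. (if k \<in> F then c k else 0) * e k x)"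
      using F G by (intro sum.mono_neutral_cong_left) auto
    moreover have "(\<Sum>k\<in>G. d k * e k x) = (\<Sum>k\<in>F \<union> G. (if k \<in> G then d k else 0) * e k x)"
      using F G by (intro sum.mono_neutral_cong_left) auto
    ultimately show ?thesis by (simp only: h_def distrib_right sum.distrib)
  qed
  then have eq: "(f x - (\<Sum>k\<in>F. c k * e k x)) + (g x - (\<Sum>k\<in>G. d k * e k x)) =
      f x + g x - (\<Sum>k\<in>F \<union> G. h k * e k x)" for x
    by (simp add: algebra_simps)
  have "(\<lambda>x. \<Sum>k\<in>F. c k * e k x) \<in> L2 \<mu>" "(\<lambda>x. \<Sum>k\<in>G. d k * e k x) \<in> L2 \<mu>"
    using F G eL2 by (auto intro!: L2_linear_combination)
  from L2_add(2)[OF L2_diff[OF fg(1) this(1)] L2_diff[OF fg(2) this(2)], unfolded eq]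
  have "(\<integral>x. (norm (f x + g x - (\<Sum>k\<in>F \<union> G. h k * e k x)))\<^sup>2 \<partial>\<mu>) < \<epsilon>"
    using F(3) G(3) by simp
  with F G show "\<exists>F c. finite F \<and> F \<subseteq> I \<and>
      (\<integral>x. (norm (f x + g x - (\<Sum>k\<in>F. c k * e k x)))\<^sup>2 \<partial>\<mu>) < \<epsilon>"
    by (intro exI[of _ "F \<union> G"] exI[of _ h]) simp
qed

lemma L2_closed_span_cmult:
  assumes f: "f \<in> L2_closed_span \<mu> I e"
  shows "(\<lambda>x. a * f x) \<in> L2_closed_span \<mu> I e"
proof (cases "a = 0")
  case False
  show ?thesis
    unfolding L2_closed_span_def
  proof (intro CollectI conjI allI impI L2_cmult L2_closed_span_imp_L2[OF f])
    fix \<epsilon> :: real assume "\<epsilon> > 0"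
    then have "\<epsilon> / (norm a)\<^sup>2 > 0" using False by simp
    from L2_closed_spanE[OF f this] obtain F c where
      F: "finite F" "F \<subseteq> I" "(\<integral>x. (norm (f x - (\<Sum>k\<in>F. c k * e k x)))\<^sup>2 \<partial>\<mu>) < \<epsilon> / (norm a)\<^sup>2" .
    have "(norm (a * f x - (\<Sum>k\<in>F. (a * c k) * e k x)))\<^sup>2 =
        (norm a)\<^sup>2 * (norm (f x - (\<Sum>k\<in>F. c k * e k x)))\<^sup>2" for x
      by (simp only: mult.assoc sum_distrib_left[symmetric] right_diff_distrib[symmetric] norm_mult power_mult_distrib)
    then have "(\<integral>x. (norm (a * f x - (\<Sum>k\<in>F. (a * c k) * e k x)))\<^sup>2 \<partial>\<mu>) < \<epsilon>"
      using F(3) False by (simp add: field_simps)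
    with F show "\<exists>F c. finite F \<and> F \<subseteq> I \<and> (\<integral>x. (norm (a * f x - (\<Sum>k\<in>F. c k * e k x)))\<^sup>2 \<partial>\<mu>) < \<epsilon>"
      by (intro exI[of _ F] exI[of _ "\<lambda>k. a * c k"]) simp
  qed
qed (simp add: L2_closed_span_zero)

lemma L2_closed_span_linear_combination:
  assumes "finite F" "\<And>k. k \<in> F \<Longrightarrow> g k \<in> L2_closed_span \<mu> I e"
  shows "(\<lambda>x. \<Sum>k\<in>F. c k * g k x) \<in> L2_closed_span \<mu> I e"
  using assms
proof (induction F rule: finite_induct)
  case (insert j F)
  then have "(\<lambda>x. c j * g j x + (\<Sum>k\<in>F. c k * g k x)) \<in> L2_closed_span \<mu> I e"
    by (intro L2_closed_span_add L2_closed_span_cmult) auto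
  with insert.hyps show ?case by simp
qed (simp add: L2_closed_span_zero)

end

lemma L2_closed_span_trans:
  assumes eL2: "\<And>k. k \<in> I \<Longrightarrow> e k \<in> L2 \<mu>"
    and g: "\<And>j. j \<in> J \<Longrightarrow> g j \<in> L2_closed_span \<mu> I e"
    and f: "f \<in> L2_closed_span \<mu> J g"
  shows "f \<in> L2_closed_span \<mu> I e"
proof (rule L2_closed_span_closed[OF eL2 L2_closed_span_imp_L2[OF f]])
  fix \<epsilon> :: real assume "\<epsilon> > 0"
  from L2_closed_spanE[OF f this] obtain F c where
    F: "finite F" "F \<subseteq> J" "(\<integral>x. (norm (f x - (\<Sum>k\<in>F. c k * g k x)))\<^sup>2 \<partial>\<mu>) < \<epsilon>" .
  then show "\<exists>h\<in>L2_closed_span \<mu> I e. (\<integral>x. (norm (f x - h x))\<^sup>2 \<partial>\<mu>) < \<epsilon>"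
    using g by (intro bexI[of _ "\<lambda>x. \<Sum>k\<in>F. c k * g k x"] L2_closed_span_linear_combination[OF eL2]) auto
qed

section \<open>Cauchy kernels along a Stolz angle\<close>

lemma cauchy_kernel_in_L2:
  assumes "finite_circle_measure \<sigma>" "norm z < 1"
  shows "(\<lambda>\<xi>. 1 / (\<xi> - z)) \<in> L2 \<sigma>"
proof -
  have m: "(\<lambda>\<xi>. 1 / (\<xi> - z)) \<in> borel_measurable borel" by measurable
  have "integrable \<sigma> (\<lambda>\<xi>. complex_of_real ((norm (1 / (\<xi> - z)))\<^sup>2))"
    unfolding complex_norm_square by (rule integrable_cauchy_kernel_product) (use assms in auto)
  then show ?thesis
    using borel_measurable_circle_measure[OF assms(1) m]
    by (simp only: L2_def mem_Collect_eq complex_of_real_integrable_eq)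
qed

text \<open>Taylor expansion of the kernel in \<open>z\<close> at \<open>\<zeta>\<close>: the coefficients are poles at \<open>\<zeta>\<close>, and the
  remainder divided by \<open>(z - \<zeta>) ^ n\<close> tends pointwise to the next pole.\<close>

lemma cauchy_kernel_expansion:
  fixes \<xi> z \<zeta> :: complex
  assumes "\<xi> \<noteq> \<zeta>" "\<xi> \<noteq> z"
  shows "1 / (\<xi> - z) - (\<Sum>k<n. (z - \<zeta>) ^ k * (1 / (\<xi> - \<zeta>) ^ Suc k)) =
    (z - \<zeta>) ^ n * (1 / ((\<xi> - \<zeta>) ^ n * (\<xi> - z)))"
proof (induction n)
  case (Suc n)
  have "1 / (\<xi> - z) - (\<Sum>k<Suc n. (z - \<zeta>) ^ k * (1 / (\<xi> - \<zeta>) ^ Suc k)) =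
      (z - \<zeta>) ^ n * (1 / ((\<xi> - \<zeta>) ^ n * (\<xi> - z))) - (z - \<zeta>) ^ n * (1 / (\<xi> - \<zeta>) ^ Suc n)"
    by (simp only: sum.lessThan_Suc diff_diff_eq[symmetric] Suc.IH)
  also have "\<dots> = (z - \<zeta>) ^ Suc n * (1 / ((\<xi> - \<zeta>) ^ Suc n * (\<xi> - z)))"
    using assms by (simp add: divide_simps) (simp add: algebra_simps)
  finally show ?case .
qed simp

text \<open>Inside a Stolz angle, \<open>z\<close> is not much closer to a point of the circle than \<open>\<zeta>\<close> is, because
  \<open>1 - norm z\<close> is a lower bound for the distance of \<open>z\<close> from the circle. This makes the poles at \<open>\<zeta>\<close>
  dominate the kernels \<open>1 / (\<xi> - z)\<close> uniformly in \<open>z\<close>.\<close>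

lemma stolz_angle_dist_le:
  assumes "z \<in> stolz_angle \<gamma> \<zeta>" "\<gamma> \<ge> 0" "norm \<xi> = 1"
  shows "norm (\<xi> - \<zeta>) \<le> (1 + \<gamma>) * norm (\<xi> - z)"
proof -
  have "norm (\<xi> - \<zeta>) \<le> norm (\<xi> - z) + norm (z - \<zeta>)"
    using norm_triangle_ineq[of "\<xi> - z" "z - \<zeta>"] by simp
  also have "norm (z - \<zeta>) \<le> \<gamma> * (1 - norm z)" using assms by (simp add: stolz_angle_def)
  also have "\<dots> \<le> \<gamma> * norm (\<xi> - z)"
    using assms norm_triangle_ineq2[of \<xi> z] by (intro mult_left_mono) auto
  finally show ?thesis by (simp add: algebra_simps)
qed

text \<open>Induction on the order of the pole. Once the poles of order at most \<open>n\<close> lie in the closed span, so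
  does the remainder of the kernel expansion divided by \<open>(z - \<zeta>) ^ n\<close>, that is,
  \<open>1 / ((\<xi> - \<zeta>) ^ n * (\<xi> - z))\<close>, for every \<open>z \<in> Z\<close>. As \<open>z\<close> tends to \<open>\<zeta>\<close>, this converges in
  \<open>L\<^sup>2(\<sigma>)\<close> to the pole of order \<open>n + 1\<close>: the difference is at most
  \<open>norm (z - \<zeta>) * (1 + \<gamma>)\<close> times the pole of order \<open>n + 2\<close>, which is square integrable.\<close>

lemma poles_in_closed_span_cauchy_kernels:
  assumes \<sigma>: "finite_circle_measure \<sigma>" and \<zeta>: "emeasure \<sigma> {\<zeta>} = 0" "norm \<zeta> = 1"
    and poles: "\<And>k. k \<ge> 1 \<Longrightarrow> (\<lambda>\<xi>. 1 / (\<xi> - \<zeta>) ^ k) \<in> L2 \<sigma>"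
    and Z: "Z \<subseteq> stolz_angle \<gamma> \<zeta>" "\<zeta> islimpt Z" and \<gamma>: "\<gamma> \<ge> 0"
  shows "k \<ge> 1 \<Longrightarrow> (\<lambda>\<xi>. 1 / (\<xi> - \<zeta>) ^ k) \<in> L2_closed_span \<sigma> Z (\<lambda>z \<xi>. 1 / (\<xi> - z))"
proof (induction k rule: less_induct)
  case (less k)
  then obtain n where k: "k = Suc n" by (cases k) auto
  have Zb: "norm z < 1" if "z \<in> Z" for z using that Z by (auto simp: stolz_angle_def)
  have eL2: "(\<lambda>\<xi>. 1 / (\<xi> - z)) \<in> L2 \<sigma>" if "z \<in> Z" for z
    using cauchy_kernel_in_L2[OF \<sigma> Zb[OF that]] .
  define C where "C = (\<integral>\<xi>. (norm (1 / (\<xi> - \<zeta>) ^ Suc (Suc n)))\<^sup>2 \<partial>\<sigma>)"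
  have intC: "integrable \<sigma> (\<lambda>\<xi>. (norm (1 / (\<xi> - \<zeta>) ^ Suc (Suc n)))\<^sup>2)"
    using poles[of "Suc (Suc n)"] by (simp add: L2_def del: power_Suc)
  have C: "C \<ge> 0" unfolding C_def by (intro Bochner_Integration.integral_nonneg) simp
  have ae: "AE \<xi> in \<sigma>. \<xi> \<noteq> \<zeta> \<and> norm \<xi> = 1"
  proof -
    have "{\<zeta>} \<in> null_sets \<sigma>"
    proof -
      have "{\<zeta>} \<in> sets circle_borel"
        unfolding circle_borel_def using \<zeta>(2) by (subst sets_restrict_space_iff) auto
      then show ?thesis using \<sigma> \<zeta>(1) by (simp add: null_sets_def finite_circle_measure_def)
    qed
    then have "AE \<xi> in \<sigma>. \<xi> \<notin> {\<zeta>}" by (rule AE_not_in)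
    moreover have "AE \<xi> in \<sigma>. norm \<xi> = 1" using space_circle_measure[OF \<sigma>] by (intro AE_I2) auto
    ultimately show ?thesis by eventually_elim auto
  qed
  show ?case
  proof (rule L2_closed_span_closed[OF eL2 poles[OF less.prems]])
    fix \<epsilon> :: real assume \<epsilon>: "\<epsilon> > 0"
    \<comment> \<open>The summand \<open>1\<close> keeps \<open>P\<close> positive when \<open>C = 0\<close>.\<close>
    define P where "P = (1 + \<gamma>)\<^sup>2 * (C + 1)"
    define \<delta> where "\<delta> = sqrt (\<epsilon> / P)"
    have pos: "P > 0" unfolding P_def using C \<gamma> by (intro mult_pos_pos) auto
    then have \<delta>: "\<delta> > 0" "\<delta>\<^sup>2 * P = \<epsilon>" using \<epsilon> by (auto simp: \<delta>_def)
    from Z(2) \<delta>(1) obtain z where z: "z \<in> Z" "z \<noteq> \<zeta>" "norm (z - \<zeta>) < \<delta>"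
      by (auto simp: islimpt_approachable dist_norm)
    have zS: "z \<in> stolz_angle \<gamma> \<zeta>" using z Z by auto
    \<comment> \<open>Equal to \<open>1 / ((\<xi> - \<zeta>) ^ n * (\<xi> - z))\<close> off \<open>\<zeta>\<close>, in a form that shows it to lie in the span.\<close>
    define h where "h = (\<lambda>\<xi>. 1 / (z - \<zeta>) ^ n *
      (1 / (\<xi> - z) + - 1 * (\<Sum>j<n. (z - \<zeta>) ^ j * (1 / (\<xi> - \<zeta>) ^ Suc j))))"
    have h: "h \<in> L2_closed_span \<sigma> Z (\<lambda>z \<xi>. 1 / (\<xi> - z))"
    proof -
      let ?e = "\<lambda>z \<xi>. 1 / (\<xi> - z)"
      note closure = L2_closed_span_base[of Z ?e \<sigma>] L2_closed_span_add[of Z ?e \<sigma>]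
        L2_closed_span_cmult[of Z ?e \<sigma>] L2_closed_span_linear_combination[of Z ?e \<sigma>]
      have "(\<lambda>\<xi>. \<Sum>j<n. (z - \<zeta>) ^ j * (1 / (\<xi> - \<zeta>) ^ Suc j)) \<in> L2_closed_span \<sigma> Z ?e"
        by (rule closure(4)[where g = "\<lambda>j \<xi>. 1 / (\<xi> - \<zeta>) ^ Suc j"]) 
           (auto simp: k intro!: less.IH eL2 simp del: power_Suc)
      from closure(3)[OF eL2 this, of "- 1"]
      have "(\<lambda>\<xi>. 1 / (\<xi> - z) + - 1 * (\<Sum>j<n. (z - \<zeta>) ^ j * (1 / (\<xi> - \<zeta>) ^ Suc j)))
          \<in> L2_closed_span \<sigma> Z ?e"
        using closure(1)[OF eL2 z(1)] by (intro closure(2)) (use eL2 in auto)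
      from closure(3)[OF eL2 this, of "1 / (z - \<zeta>) ^ n"] show ?thesis
        unfolding h_def .
    qed
    have pointwise: "(norm (1 / (\<xi> - \<zeta>) ^ k - h \<xi>))\<^sup>2 \<le>
        (norm (z - \<zeta>))\<^sup>2 * (1 + \<gamma>)\<^sup>2 * (norm (1 / (\<xi> - \<zeta>) ^ Suc (Suc n)))\<^sup>2"
      if "\<xi> \<noteq> \<zeta>" "norm \<xi> = 1" for \<xi>
    proof -
      have ne: "\<xi> \<noteq> z" using that Zb[OF z(1)] by auto
      have h_eq: "h \<xi> = 1 / ((\<xi> - \<zeta>) ^ n * (\<xi> - z))"
        unfolding h_def mult_minus1 add_uminus_conv_diff cauchy_kernel_expansion[OF that(1) ne]
        using z(2) by simp
      have "1 / (\<xi> - \<zeta>) ^ k - h \<xi> = - (z - \<zeta>) * (1 / (\<xi> - \<zeta>) ^ Suc n) * (1 / (\<xi> - z))"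
      proof -
        have "1 / A ^ Suc n - 1 / (A ^ n * B) = (B - A) * (1 / A ^ Suc n) * (1 / B)"
          if "A \<noteq> 0" "B \<noteq> 0" for A B :: complex
          using that by (simp add: field_simps)
        from this[of "\<xi> - \<zeta>" "\<xi> - z"] show ?thesis
          using that ne h_eq by (simp add: k)
      qed
      moreover have "norm (1 / (\<xi> - z)) \<le> (1 + \<gamma>) * norm (1 / (\<xi> - \<zeta>))"
        using stolz_angle_dist_le[OF zS \<gamma> that(2)] that ne by (simp add: norm_divide divide_simps mult.commute)
      ultimately have "norm (1 / (\<xi> - \<zeta>) ^ k - h \<xi>) \<le>
          norm (z - \<zeta>) * norm (1 / (\<xi> - \<zeta>) ^ Suc n) * ((1 + \<gamma>) * norm (1 / (\<xi> - \<zeta>)))"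
        by (simp only: norm_mult norm_minus_cancel) (intro mult_left_mono, auto)
      also have "\<dots> = norm (z - \<zeta>) * (1 + \<gamma>) * norm (1 / (\<xi> - \<zeta>) ^ Suc (Suc n))"
        by (simp add: norm_divide norm_mult norm_power)
      finally have "(norm (1 / (\<xi> - \<zeta>) ^ k - h \<xi>))\<^sup>2 \<le>
          (norm (z - \<zeta>) * (1 + \<gamma>) * norm (1 / (\<xi> - \<zeta>) ^ Suc (Suc n)))\<^sup>2"
        by (intro power_mono) auto
      then show ?thesis by (simp only: power_mult_distrib)
    qed
    have "(\<integral>\<xi>. (norm (1 / (\<xi> - \<zeta>) ^ k - h \<xi>))\<^sup>2 \<partial>\<sigma>) \<le>
        (\<integral>\<xi>. (norm (z - \<zeta>))\<^sup>2 * (1 + \<gamma>)\<^sup>2 * (norm (1 / (\<xi> - \<zeta>) ^ Suc (Suc n)))\<^sup>2 \<partial>\<sigma>)"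
    proof (rule integral_mono_AE)
      show "integrable \<sigma> (\<lambda>\<xi>. (norm (1 / (\<xi> - \<zeta>) ^ k - h \<xi>))\<^sup>2)"
        using L2_diff[OF poles[OF less.prems] L2_closed_span_imp_L2[OF h]]
        unfolding L2_def by blast
      show "integrable \<sigma> (\<lambda>\<xi>. (norm (z - \<zeta>))\<^sup>2 * (1 + \<gamma>)\<^sup>2 * (norm (1 / (\<xi> - \<zeta>) ^ Suc (Suc n)))\<^sup>2)"
        by (intro integrable_mult_right intC)
      show "AE \<xi> in \<sigma>. (norm (1 / (\<xi> - \<zeta>) ^ k - h \<xi>))\<^sup>2 \<le>
          (norm (z - \<zeta>))\<^sup>2 * (1 + \<gamma>)\<^sup>2 * (norm (1 / (\<xi> - \<zeta>) ^ Suc (Suc n)))\<^sup>2"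
        using ae by eventually_elim (rule pointwise, auto)
    qed
    also have "\<dots> = (norm (z - \<zeta>))\<^sup>2 * ((1 + \<gamma>)\<^sup>2 * C)"
      unfolding C_def by (simp only: integral_mult_right_zero mult.assoc)
    also have "\<dots> \<le> (norm (z - \<zeta>))\<^sup>2 * P"
      unfolding P_def by (intro mult_left_mono) auto
    also have "\<dots> < \<delta>\<^sup>2 * P"
      using z(3) by (intro mult_strict_right_mono power_strict_mono pos) simp_all
    finally show "\<exists>g\<in>L2_closed_span \<sigma> Z (\<lambda>z \<xi>. 1 / (\<xi> - z)).
        (\<integral>\<xi>. (norm (1 / (\<xi> - \<zeta>) ^ k - g \<xi>))\<^sup>2 \<partial>\<sigma>) < \<epsilon>"
      unfolding \<delta>(2) by (intro bexI[of _ h] h)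
  qed
qed

section \<open>Localization\<close>

text \<open>Apply the evaluation bound to \<open>1 / (\<xi> - w)\<close> minus an approximating combination of kernels at zeros
  of \<open>f\<close>: the evaluations at the zeros contribute nothing, so \<open>f w / (\<alpha> - \<theta> w)\<close> is arbitrarily small.\<close>

lemma model_space_zero_if_kernel_in_closed_span:
  assumes \<theta>: "\<theta> holomorphic_on ball 0 1" "\<And>z. z \<in> ball 0 1 \<Longrightarrow> norm (\<theta> z) < 1"
    and \<alpha>: "norm \<alpha> = 1" and clark: "clark_measure \<theta> \<alpha> \<sigma>" and f: "f \<in> model_space \<theta>"
    and Z: "Z \<subseteq> ball 0 1" "\<And>z. z \<in> Z \<Longrightarrow> f z = 0" and w: "w \<in> ball 0 1"
    and span: "(\<lambda>\<xi>. 1 / (\<xi> - w)) \<in> L2_closed_span \<sigma> Z (\<lambda>z \<xi>. 1 / (\<xi> - z))"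
  shows "f w = 0"
proof (cases "w \<in> Z")
  case False
  define M where "M = (\<Sum>n. (norm (taylor_coeff f n))\<^sup>2)"
  have M: "M \<ge> 0" unfolding M_def using f by (auto simp: model_space_def H2_def intro: suminf_nonneg)
  have "(norm (f w / (\<alpha> - \<theta> w)))\<^sup>2 \<le> \<epsilon>" if \<epsilon>: "\<epsilon> > 0" for \<epsilon> :: real
  proof -
    have "\<epsilon> / (M + 1) > 0" using \<epsilon> M by simp
    from L2_closed_spanE[OF span this] obtain F c where F: "finite F" "F \<subseteq> Z"
      "(\<integral>\<xi>. (norm (1 / (\<xi> - w) - (\<Sum>z\<in>F. c z * (1 / (\<xi> - z)))))\<^sup>2 \<partial>\<sigma>) < \<epsilon> / (M + 1)" .
    have wF: "w \<notin> F" using F False by auto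
    \<comment> \<open>Coefficients of \<open>1 / (\<xi> - w)\<close> minus its approximation.\<close>
    define b where "b z = (if z = w then 1 else - c z)" for z
    have sum_b: "(\<Sum>z\<in>insert w F. b z * u z) = u w - (\<Sum>z\<in>F. c z * u z)" for u
    proof -
      have "(\<Sum>z\<in>F. b z * u z) = (\<Sum>z\<in>F. - (c z * u z))"
        using wF by (intro sum.cong) (auto simp: b_def)
      moreover have "b w = 1" by (simp add: b_def)
      ultimately show ?thesis using F(1) wF by (simp add: sum_negf)
    qed
    have "(\<Sum>z\<in>insert w F. b z * (f z / (\<alpha> - \<theta> z))) = f w / (\<alpha> - \<theta> w)"
      unfolding sum_b using F Z(2) by (simp add: subset_eq)
    moreover have "insert w F \<subseteq> ball 0 1" using w F Z by auto
    ultimately have "(norm (f w / (\<alpha> - \<theta> w)))\<^sup>2 \<le>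
        M * (\<integral>\<xi>. (norm (1 / (\<xi> - w) - (\<Sum>z\<in>F. c z * (1 / (\<xi> - z)))))\<^sup>2 \<partial>\<sigma>)"
      using clark_evaluation_bound[OF \<theta> \<alpha> clark f, of "insert w F" b] F(1)
      unfolding sum_b M_def by (simp only: finite_insert)
    also have "\<dots> \<le> M * (\<epsilon> / (M + 1))" using F(3) M by (intro mult_left_mono) auto
    also have "\<dots> \<le> \<epsilon>" using M \<epsilon> by (simp add: field_simps)
    finally show ?thesis .
  qed
  then have "(norm (f w / (\<alpha> - \<theta> w)))\<^sup>2 \<le> 0" by (rule field_le_epsilon) simp
  then have "f w / (\<alpha> - \<theta> w) = 0" by simp
  then show ?thesis using \<theta>(2)[OF w] \<alpha> by auto
qed (rule Z(2))

text \<open>An infinite bounded set has a limit point. It cannot lie in the open disc by the identity theorem,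
  and \<open>\<zeta>\<close> is the only point of the closed Stolz angle on the unit circle.\<close>

lemma infinite_zeros_stolz_angle_islimpt:
  assumes f: "f holomorphic_on ball 0 1" "a \<in> ball 0 1" "f a \<noteq> 0" and \<gamma>: "\<gamma> \<ge> 0"
    and inf: "infinite Z" and Z: "Z \<subseteq> stolz_angle \<gamma> \<zeta>" "\<And>z. z \<in> Z \<Longrightarrow> f z = 0"
  shows "\<zeta> islimpt Z"
proof -
  let ?K = "cball 0 1 \<inter> {z. norm (z - \<zeta>) \<le> \<gamma> * (1 - norm z)}"
  have "compact ?K"
    by (intro compact_Int_closed compact_cball closed_Collect_le continuous_intros)
  moreover have "Z \<subseteq> ?K" using Z by (auto simp: stolz_angle_def)
  ultimately obtain p where p: "p \<in> ?K" "p islimpt Z"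
    using inf unfolding compact_eq_Bolzano_Weierstrass by meson
  have "p \<notin> ball 0 1"
  proof
    assume "p \<in> ball 0 1"
    moreover have "Z \<subseteq> ball 0 1" using Z by (auto simp: stolz_angle_def)
    ultimately have "f a = 0"
      using analytic_continuation[OF f(1) open_ball connected_ball, of Z p a] p Z f by blast
    with f show False by simp
  qed
  with p have "norm p = 1" by auto
  with p have "p = \<zeta>" by auto
  with p show ?thesis by simp
qed

theorem corollary1p7:
  fixes \<theta> :: "complex \<Rightarrow> complex" and \<zeta> :: complex
  assumes "inner_function \<theta>"
    and "\<not> \<theta> constant_on ball 0 1"
    and "\<zeta> \<in> sphere 0 1"
    and "strong_localization \<theta> \<zeta>"
  shows "localization_property \<theta> \<zeta>"
  unfolding localization_property_def
proof (intro ballI impI allI; elim bexE)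
  fix f \<gamma> a assume f: "f \<in> model_space \<theta>" and a: "a \<in> ball 0 1" "f a \<noteq> 0" and \<gamma>: "\<gamma> > (1::real)"
  have \<theta>: "\<theta> holomorphic_on ball 0 1" "\<And>z. z \<in> ball 0 1 \<Longrightarrow> norm (\<theta> z) < 1"
    using assms(1,2) norm_less_1_if_nonconstant[of \<theta>] by (auto simp: inner_function_def)
  obtain \<alpha> \<sigma> where \<alpha>: "norm \<alpha> = 1" and clark: "clark_measure \<theta> \<alpha> \<sigma>" and \<zeta>: "emeasure \<sigma> {\<zeta>} = 0"
    and complete: "complete_in_L2 \<sigma> {1::nat..} (\<lambda>k z. 1 / (z - \<zeta>) ^ k)"
    using assms(4) unfolding strong_localization_def by auto
  have \<sigma>: "finite_circle_measure \<sigma>" using clark by (simp add: clark_measure_def)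
  let ?Z = "{z \<in> stolz_angle \<gamma> \<zeta>. f z = 0}"
  have Zb: "?Z \<subseteq> ball 0 1" by (auto simp: stolz_angle_def)
  show "finite ?Z"
  proof (rule ccontr)
    assume inf: "infinite ?Z"
    have hol: "f holomorphic_on ball 0 1" using f by (simp add: model_space_def H2_def)
    have Z: "?Z \<subseteq> stolz_angle \<gamma> \<zeta>" "\<And>z. z \<in> ?Z \<Longrightarrow> f z = 0" by auto
    have "\<gamma> \<ge> 0" using \<gamma> by simp
    note lim = infinite_zeros_stolz_angle_islimpt[OF hol a this inf Z]
    have poles: "(\<lambda>\<xi>. 1 / (\<xi> - \<zeta>) ^ k) \<in> L2_closed_span \<sigma> ?Z (\<lambda>z \<xi>. 1 / (\<xi> - z))" if "k \<in> {1..}" for k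
    proof (rule poles_in_closed_span_cauchy_kernels[where \<gamma> = \<gamma>, OF \<sigma> \<zeta> _ _ _ lim])
      show "(\<lambda>\<xi>. 1 / (\<xi> - \<zeta>) ^ j) \<in> L2 \<sigma>" if "j \<ge> 1" for j
        using complete that unfolding complete_in_L2_def by simp
      show "norm \<zeta> = 1" using assms(3) by simp
    qed (use that \<gamma> in simp_all)
    have "L2 \<sigma> \<subseteq> L2_closed_span \<sigma> {1::nat..} (\<lambda>k z. 1 / (z - \<zeta>) ^ k)"
      using complete unfolding complete_in_L2_iff by (rule conjunct2)
    moreover have "(\<lambda>\<xi>. 1 / (\<xi> - a)) \<in> L2 \<sigma>"
      by (rule cauchy_kernel_in_L2[OF \<sigma>]) (use a(1) in simp)
    ultimately have "(\<lambda>\<xi>. 1 / (\<xi> - a)) \<in> L2_closed_span \<sigma> {1::nat..} (\<lambda>k z. 1 / (z - \<zeta>) ^ k)"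
      by (rule subsetD)
    then have span: "(\<lambda>\<xi>. 1 / (\<xi> - a)) \<in> L2_closed_span \<sigma> ?Z (\<lambda>z \<xi>. 1 / (\<xi> - z))"
    proof (rule L2_closed_span_trans[rotated 2])
      show "(\<lambda>\<xi>. 1 / (\<xi> - z)) \<in> L2 \<sigma>" if "z \<in> ?Z" for z
        by (rule cauchy_kernel_in_L2[OF \<sigma>]) (use that Zb in auto)
    qed (rule poles)
    have "f a = 0"
      by (rule model_space_zero_if_kernel_in_closed_span[of \<theta> \<alpha> \<sigma> f ?Z a])
         (fact \<theta> \<alpha> clark f Zb Z a(1) span)+
    with a(2) show False by simp
  qed
qed

end
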